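(* Let $d_{A_0}=d_{B_0}$ and $d_{A_1}=d_{B_1}$. Every doubly stochastic superchannel $\Theta:\mathcal L^A\to\mathcal L^B$ is completely uniformity preserving.
   Context: All Hilbert spaces are finite-dimensional; $d_S=\dim\mathcal H^S$. Each party $A$ has an input system $A_0$ and an output system $A_1$. $\mathcal L^A$ is the space of linear maps $\mathcal B(\mathcal H^{A_0})\to\mathcal B(\mathcal H^{A_1})$; $\mathcal L^{AC}=\mathcal L^A\otimes\mathcal L^C$ is the space of linear maps $\mathcal B(\mathcal H^{A_0C_0})\to\mathcal B(\mathcal H^{A_1C_1})$. A channel is a completely positive trace-preserving map. $\mathbb 1^C$ is the identity map on $\mathcal L^C$. $u^S=I^S/d_S$. Superchannel: a linear map $\Theta:\mathcal L^A\to\mathcal L^B$ such that (i) for every party $C=(C_0,C_1)$, $\mathbb 1^C\otimes\Theta$ sends completely positive maps to completely positive maps, and (ii) $\Theta$ sends trace-preserving maps to trace-preserving maps. Inner product on $\mathcal L^A$: $\langle\Phi,\Psi\rangle=\sum_{i,j}\mathrm{Tr}[\Phi(|i\rangle\langle j|)^*\,\Psi(|i\rangle\langle j|)]$ ($*$ on operators is the adjoint). The dual $\Theta^*:\mathcal L^B\to\mathcal L^A$ is defined by $\langle\Phi,\Theta^*[\Psi]\rangle=\langle\Theta[\Phi],\Psi\rangle$ for all $\Phi\in\mathcal L^A$, $\Psi\in\mathcal L^B$. $\Theta$ is doubly stochastic if both $\Theta$ and $\Theta^*$ are superchannels. A bipartite channel $\Phi^{AC}$ is marginally uniform on $A$ if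 $\Phi^{AC}(\rho)=u^{A_1}\otimes\mathrm{Tr}_{A_1}[\Phi^{AC}(\rho)]$ for all $\rho\in\mathcal B(\mathcal H^{A_0C_0})$. A superchannel $\Theta:\mathcal L^A\to\mathcal L^B$ (with $d_{A_0}=d_{B_0}$, $d_{A_1}=d_{B_1}$) is completely uniformity preserving if for every party $C$ and every channel $\Phi^{AC}$ marginally uniform on $A$, the channel $(\Theta\otimes\mathbb 1^C)[\Phi^{AC}]$ is marginally uniform on $B$. *)

theory Defs
  imports "HOL-Library.FuncSet" "Jordan_Normal_Form.Schur_Decomposition"
begin

section \<open>Operators on finite-dimensional Hilbert spaces\<close>

text \<open>
  A Hilbert space of dimension \<open>d\<close> is identified, by an orthonormal basis, with complex
  column vectors of length \<open>d\<close>, and the operators on it with \<open>carrier_mat d d\<close>.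
  Dimensions have to be terms because the definitions below quantify over all auxiliary parties.
  The basis vector \<open>|i\<rangle> \<otimes> |k\<rangle>\<close> of a tensor product with second factor of dimension \<open>c\<close> has
  index \<open>i * c + k\<close>.
\<close>

abbreviation ops :: "nat \<Rightarrow> complex mat set" where
  "ops d \<equiv> carrier_mat d d"

definition mat_tensor :: "complex mat \<Rightarrow> complex mat \<Rightarrow> complex mat"  (infixl \<open>\<otimes>\<^sub>M\<close> 70) where
  "X \<otimes>\<^sub>M Y = mat (dim_row X * dim_row Y) (dim_col X * dim_col Y)
     (\<lambda>(r, s). X $$ (r div dim_row Y, s div dim_col Y) * Y $$ (r mod dim_row Y, s mod dim_col Y))"

text \<open>The operator \<open>|i\<rangle>\<langle>j|\<close>.\<close>

definition unit_op :: "nat \<Rightarrow> nat \<Rightarrow> nat \<Rightarrow> complex mat" where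
  "unit_op d i j = mat d d (\<lambda>(r, s). if r = i \<and> s = j then 1 else 0)"

definition trace :: "complex mat \<Rightarrow> complex" where
  "trace X = (\<Sum>i<dim_row X. X $$ (i, i))"

text \<open>Partial trace over the first factor of dimension \<open>d\<close>; the second has dimension \<open>c\<close>.\<close>

definition ptrace1 :: "nat \<Rightarrow> nat \<Rightarrow> complex mat \<Rightarrow> complex mat" where
  "ptrace1 d c X = mat c c (\<lambda>(k, l). \<Sum>i<d. X $$ (i * c + k, i * c + l))"

text \<open>
  The order on \<^typ>\<open>complex\<close> is that of \<^theory>\<open>HOL-Library.Complex_Order\<close>, so \<open>0 \<le> z\<close> includes
  that \<open>z\<close> is real; hence positive operators are self-adjoint.
\<close>

definition psd :: "nat \<Rightarrow> complex mat \<Rightarrow> bool" where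
  "psd d X \<longleftrightarrow> X \<in> ops d \<and> (\<forall>v\<in>carrier_vec d. 0 \<le> (X *\<^sub>v v) \<bullet>c v)"

definition uniform_state :: "nat \<Rightarrow> complex mat" where
  "uniform_state d = (1 / of_nat d) \<cdot>\<^sub>m 1\<^sub>m d"


section \<open>Parties, linear maps and channels\<close>

datatype party = Party (din: nat) (dout: nat)

definition party_tensor :: "party \<Rightarrow> party \<Rightarrow> party"  (infixl \<open>\<otimes>\<^sub>P\<close> 70) where
  "A \<otimes>\<^sub>P C = Party (din A * din C) (dout A * dout C)"

type_synonym cmap = "complex mat \<Rightarrow> complex mat"

text \<open>
  The space \<open>\<L>\<^sup>A\<close>. Its elements are extensional functions, so that equality in \<open>\<L>\<^sup>A\<close>
  is equality in HOL. The space \<open>\<L>\<^sup>A \<otimes> \<L>\<^sup>C\<close> is \<open>lin_maps (A \<otimes>\<^sub>P C)\<close>.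
\<close>

definition lin_maps :: "party \<Rightarrow> cmap set" where
  "lin_maps A = {\<Phi> \<in> ops (din A) \<rightarrow>\<^sub>E ops (dout A).
     (\<forall>X\<in>ops (din A). \<forall>Y\<in>ops (din A). \<Phi> (X + Y) = \<Phi> X + \<Phi> Y) \<and>
     (\<forall>c. \<forall>X\<in>ops (din A). \<Phi> (c \<cdot>\<^sub>m X) = c \<cdot>\<^sub>m \<Phi> X)}"

definition lmap_add :: "party \<Rightarrow> cmap \<Rightarrow> cmap \<Rightarrow> cmap" where
  "lmap_add A \<Phi> \<Psi> = (\<lambda>X\<in>ops (din A). \<Phi> X + \<Psi> X)"

definition lmap_smult :: "party \<Rightarrow> complex \<Rightarrow> cmap \<Rightarrow> cmap" where
  "lmap_smult A c \<Phi> = (\<lambda>X\<in>ops (din A). c \<cdot>\<^sub>m \<Phi> X)"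

text \<open>
  The tensor product of \<open>f \<in> \<L>\<^sup>A\<close> and \<open>g \<in> \<L>\<^sup>C\<close>, obtained by expanding the argument in the
  operators \<open>|i\<rangle>\<langle>j| \<otimes> |k\<rangle>\<langle>l|\<close>; see \<open>map_tensor_mat_tensor\<close> below.
\<close>

definition map_tensor :: "party \<Rightarrow> party \<Rightarrow> cmap \<Rightarrow> cmap \<Rightarrow> cmap" where
  "map_tensor A C f g = (\<lambda>X\<in>ops (din A * din C).
     mat (dout A * dout C) (dout A * dout C) (\<lambda>(r, s).
       \<Sum>i<din A. \<Sum>j<din A. \<Sum>k<din C. \<Sum>l<din C.
         X $$ (i * din C + k, j * din C + l) *
         (f (unit_op (din A) i j) \<otimes>\<^sub>M g (unit_op (din C) k l)) $$ (r, s)))"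

definition completely_positive :: "party \<Rightarrow> cmap \<Rightarrow> bool" where
  "completely_positive A \<Phi> \<longleftrightarrow> \<Phi> \<in> lin_maps A \<and>
     (\<forall>n. \<forall>X. psd (n * din A) X \<longrightarrow>
        psd (n * dout A) (map_tensor (Party n n) A (\<lambda>Y\<in>ops n. Y) \<Phi> X))"

definition trace_preserving :: "party \<Rightarrow> cmap \<Rightarrow> bool" where
  "trace_preserving A \<Phi> \<longleftrightarrow> \<Phi> \<in> lin_maps A \<and> (\<forall>X\<in>ops (din A). trace (\<Phi> X) = trace X)"

definition channel :: "party \<Rightarrow> cmap \<Rightarrow> bool" where
  "channel A \<Phi> \<longleftrightarrow> completely_positive A \<Phi> \<and> trace_preserving A \<Phi>"

definition map_inner :: "party \<Rightarrow> cmap \<Rightarrow> cmap \<Rightarrow> complex" where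
  "map_inner A \<Phi> \<Psi> = (\<Sum>i<din A. \<Sum>j<din A.
     trace (mat_adjoint (\<Phi> (unit_op (din A) i j)) * \<Psi> (unit_op (din A) i j)))"


section \<open>Supermaps and superchannels\<close>

type_synonym supermap = "cmap \<Rightarrow> cmap"

definition supermaps :: "party \<Rightarrow> party \<Rightarrow> supermap set" where
  "supermaps A B = {\<Theta> \<in> lin_maps A \<rightarrow>\<^sub>E lin_maps B.
     (\<forall>\<Phi>\<in>lin_maps A. \<forall>\<Psi>\<in>lin_maps A.
        \<Theta> (lmap_add A \<Phi> \<Psi>) = lmap_add B (\<Theta> \<Phi>) (\<Theta> \<Psi>)) \<and>
     (\<forall>c. \<forall>\<Phi>\<in>lin_maps A. \<Theta> (lmap_smult A c \<Phi>) = lmap_smult B c (\<Theta> \<Phi>))}"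

definition id_supermap :: "party \<Rightarrow> supermap" where
  "id_supermap C = (\<lambda>\<Phi>\<in>lin_maps C. \<Phi>)"

text \<open>
  The basis \<open>X \<mapsto> \<langle>i|X|j\<rangle> |k\<rangle>\<langle>l|\<close> of \<open>\<L>\<^sup>A\<close>, indexed by \<open>(i, j, k, l) \<in> map_idx A\<close>.
  The coefficient of \<open>\<Phi>\<close> at this basis element is \<open>\<langle>k|\<Phi>(|i\<rangle>\<langle>j|)|l\<rangle>\<close>.
\<close>

definition unit_map :: "party \<Rightarrow> nat \<Rightarrow> nat \<Rightarrow> nat \<Rightarrow> nat \<Rightarrow> cmap" where
  "unit_map A i j k l = (\<lambda>X\<in>ops (din A). X $$ (i, j) \<cdot>\<^sub>m unit_op (dout A) k l)"

definition map_idx :: "party \<Rightarrow> (nat \<times> nat \<times> nat \<times> nat) set" where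
  "map_idx A = {..<din A} \<times> {..<din A} \<times> {..<dout A} \<times> {..<dout A}"

text \<open>
  The tensor product of \<open>\<Theta> : \<L>\<^sup>A \<rightarrow> \<L>\<^sup>B\<close> and \<open>\<Xi> : \<L>\<^sup>C \<rightarrow> \<L>\<^sup>D\<close>, obtained by expanding the argument in
  the tensor products of basis elements of \<open>\<L>\<^sup>A\<close> and \<open>\<L>\<^sup>C\<close>; see \<open>supermap_tensor_map_tensor\<close> below.
\<close>

definition supermap_tensor ::
    "party \<Rightarrow> party \<Rightarrow> party \<Rightarrow> party \<Rightarrow> supermap \<Rightarrow> supermap \<Rightarrow> supermap" where
  "supermap_tensor A B C D \<Theta> \<Xi> = (\<lambda>\<Gamma>\<in>lin_maps (A \<otimes>\<^sub>P C). \<lambda>X\<in>ops (din B * din D).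
     mat (dout B * dout D) (dout B * dout D) (\<lambda>(r, s).
       \<Sum>(i, j, k, l)\<in>map_idx A. \<Sum>(m, n, p, q)\<in>map_idx C.
         \<Gamma> (unit_op (din A) i j \<otimes>\<^sub>M unit_op (din C) m n) $$ (k * dout C + p, l * dout C + q) *
         map_tensor B D (\<Theta> (unit_map A i j k l)) (\<Xi> (unit_map C m n p q)) X $$ (r, s)))"

definition superchannel :: "party \<Rightarrow> party \<Rightarrow> supermap \<Rightarrow> bool" where
  "superchannel A B \<Theta> \<longleftrightarrow> \<Theta> \<in> supermaps A B \<and>
     (\<forall>C \<Gamma>. completely_positive (C \<otimes>\<^sub>P A) \<Gamma> \<longrightarrow>
        completely_positive (C \<otimes>\<^sub>P B) (supermap_tensor C C A B (id_supermap C) \<Theta> \<Gamma>)) \<and>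
     (\<forall>\<Phi>. trace_preserving A \<Phi> \<longrightarrow> trace_preserving B (\<Theta> \<Phi>))"

text \<open>Existence and uniqueness of the dual are shown in \<open>ex1_dual_supermap\<close> below.\<close>

definition dual_supermap :: "party \<Rightarrow> party \<Rightarrow> supermap \<Rightarrow> supermap" where
  "dual_supermap A B \<Theta> = (THE \<Lambda>. \<Lambda> \<in> supermaps B A \<and>
     (\<forall>\<Phi>\<in>lin_maps A. \<forall>\<Psi>\<in>lin_maps B. map_inner A \<Phi> (\<Lambda> \<Psi>) = map_inner B (\<Theta> \<Phi>) \<Psi>))"

definition doubly_stochastic :: "party \<Rightarrow> party \<Rightarrow> supermap \<Rightarrow> bool" where
  "doubly_stochastic A B \<Theta> \<longleftrightarrow> superchannel A B \<Theta> \<and> superchannel B A (dual_supermap A B \<Theta>)"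

definition marginally_uniform :: "party \<Rightarrow> party \<Rightarrow> cmap \<Rightarrow> bool" where
  "marginally_uniform A C \<Phi> \<longleftrightarrow> channel (A \<otimes>\<^sub>P C) \<Phi> \<and>
     (\<forall>\<rho>\<in>ops (din A * din C).
        \<Phi> \<rho> = uniform_state (dout A) \<otimes>\<^sub>M ptrace1 (dout A) (dout C) (\<Phi> \<rho>))"

definition completely_uniformity_preserving :: "party \<Rightarrow> party \<Rightarrow> supermap \<Rightarrow> bool" where
  "completely_uniformity_preserving A B \<Theta> \<longleftrightarrow> superchannel A B \<Theta> \<and>
     (\<forall>C \<Phi>. marginally_uniform A C \<Phi> \<longrightarrow>
        marginally_uniform B C (supermap_tensor A B C C \<Theta> (id_supermap C) \<Phi>))"

section \<open>The tensor products and the dual are the intended ones\<close>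

lemma index_less: "i < a \<Longrightarrow> k < c \<Longrightarrow> i * c + k < a * (c::nat)"
proof -
  assume "i < a" and "k < c"
  then have "i * c + k < Suc i * c" by simp
  also have "\<dots> \<le> a * c" using \<open>i < a\<close> by (intro mult_right_mono) auto
  finally show ?thesis .
qed

lemma div_less_dim: "r < a * c \<Longrightarrow> r div c < (a::nat)"
  by (simp add: less_mult_imp_div_less)

lemma mod_less_dim: "r < a * c \<Longrightarrow> r mod c < (c::nat)"
  by (metis mod_less_divisor gr0I less_nat_zero_code mult_0_right)

lemma mat_tensor_carrier [simp]:
  "X \<in> ops a \<Longrightarrow> Y \<in> ops c \<Longrightarrow> X \<otimes>\<^sub>M Y \<in> ops (a * c)"
  by (auto simp: mat_tensor_def)

lemma mat_tensor_index:
  assumes "X \<in> ops a" "Y \<in> ops c" "r < a * c" "s < a * c"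
  shows "(X \<otimes>\<^sub>M Y) $$ (r, s) = X $$ (r div c, s div c) * Y $$ (r mod c, s mod c)"
  using assms by (auto simp: mat_tensor_def)

lemma mat_tensor_index':
  assumes "X \<in> ops a" "Y \<in> ops c" "i < a" "j < a" "k < c" "l < c"
  shows "(X \<otimes>\<^sub>M Y) $$ (i * c + k, j * c + l) = X $$ (i, j) * Y $$ (k, l)"
  using assms by (subst mat_tensor_index[of X a Y c]) (auto simp: index_less)

lemma unit_op_carrier [simp]: "unit_op d i j \<in> ops d"
  by (simp add: unit_op_def)

lemma lin_mapsD:
  assumes "\<Phi> \<in> lin_maps A"
  shows "X \<in> ops (din A) \<Longrightarrow> \<Phi> X \<in> ops (dout A)"
    and "X \<in> ops (din A) \<Longrightarrow> Y \<in> ops (din A) \<Longrightarrow> \<Phi> (X + Y) = \<Phi> X + \<Phi> Y"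
    and "X \<in> ops (din A) \<Longrightarrow> \<Phi> (c \<cdot>\<^sub>m X) = c \<cdot>\<^sub>m \<Phi> X"
    and "\<Phi> \<in> extensional (ops (din A))"
  using assms by (auto simp: lin_maps_def PiE_def)

lemma supermapsD:
  assumes "\<Theta> \<in> supermaps A B"
  shows "\<Phi> \<in> lin_maps A \<Longrightarrow> \<Theta> \<Phi> \<in> lin_maps B"
    and "\<Phi> \<in> lin_maps A \<Longrightarrow> \<Psi> \<in> lin_maps A \<Longrightarrow> \<Theta> (lmap_add A \<Phi> \<Psi>) = lmap_add B (\<Theta> \<Phi>) (\<Theta> \<Psi>)"
    and "\<Phi> \<in> lin_maps A \<Longrightarrow> \<Theta> (lmap_smult A c \<Phi>) = lmap_smult B c (\<Theta> \<Phi>)"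
    and "\<Theta> \<in> extensional (lin_maps A)"
  using assms by (auto simp: supermaps_def PiE_def)

lemma lin_maps_eqI:
  assumes "\<Phi> \<in> lin_maps A" "\<Psi> \<in> lin_maps A"
    and "\<And>X r s. X \<in> ops (din A) \<Longrightarrow> r < dout A \<Longrightarrow> s < dout A \<Longrightarrow> \<Phi> X $$ (r, s) = \<Psi> X $$ (r, s)"
  shows "\<Phi> = \<Psi>"
proof (rule extensionalityI[OF lin_mapsD(4)[OF assms(1)] lin_mapsD(4)[OF assms(2)]])
  fix X assume X: "X \<in> ops (din A)"
  then show "\<Phi> X = \<Psi> X"
    using lin_mapsD(1)[OF assms(1) X] lin_mapsD(1)[OF assms(2) X] assms(3)[OF X]
    by (intro eq_matI) auto
qed

lemma lin_maps_mat:
  assumes "\<And>X Y r s. X \<in> ops (din A) \<Longrightarrow> Y \<in> ops (din A) \<Longrightarrow> r < dout A \<Longrightarrow> s < dout A \<Longrightarrow>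
      f (X + Y) r s = f X r s + f Y r s"
    and "\<And>c X r s. X \<in> ops (din A) \<Longrightarrow> r < dout A \<Longrightarrow> s < dout A \<Longrightarrow> f (c \<cdot>\<^sub>m X) r s = c * f X r s"
  shows "(\<lambda>X\<in>ops (din A). mat (dout A) (dout A) (\<lambda>(r, s). f X r s)) \<in> lin_maps A"
  unfolding lin_maps_def using assms by (auto intro!: eq_matI)

lemma lmap_add_in:
  assumes "\<Phi> \<in> lin_maps A" "\<Psi> \<in> lin_maps A"
  shows "lmap_add A \<Phi> \<Psi> \<in> lin_maps A"
proof -
  note in1 = lin_mapsD[OF assms(1)] and in2 = lin_mapsD[OF assms(2)]
  have "lmap_add A \<Phi> \<Psi> = (\<lambda>X\<in>ops (din A). mat (dout A) (dout A) (\<lambda>(r, s). \<Phi> X $$ (r, s) + \<Psi> X $$ (r, s)))"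
    unfolding lmap_add_def
  proof (rule restrict_ext)
    fix X assume "X \<in> ops (din A)"
    from in1(1)[OF this] in2(1)[OF this]
    show "\<Phi> X + \<Psi> X = mat (dout A) (dout A) (\<lambda>(r, s). \<Phi> X $$ (r, s) + \<Psi> X $$ (r, s))"
      by (intro eq_matI) auto
  qed
  also have "\<dots> \<in> lin_maps A"
  proof (rule lin_maps_mat)
    fix X Y r s assume *: "X \<in> ops (din A)" "Y \<in> ops (din A)" "r < dout A" "s < dout A"
    then show "\<Phi> (X + Y) $$ (r, s) + \<Psi> (X + Y) $$ (r, s) =
        \<Phi> X $$ (r, s) + \<Psi> X $$ (r, s) + (\<Phi> Y $$ (r, s) + \<Psi> Y $$ (r, s))"
      using in1(1)[OF *(2)] in2(1)[OF *(2)] by (simp add: in1(2) in2(2))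
  next
    fix c X r s assume *: "X \<in> ops (din A)" "r < dout A" "s < dout A"
    then show "\<Phi> (c \<cdot>\<^sub>m X) $$ (r, s) + \<Psi> (c \<cdot>\<^sub>m X) $$ (r, s) = c * (\<Phi> X $$ (r, s) + \<Psi> X $$ (r, s))"
      using in1(1)[OF *(1)] in2(1)[OF *(1)] by (simp add: in1(3) in2(3) distrib_left)
  qed
  finally show ?thesis .
qed

lemma lmap_smult_in:
  assumes "\<Phi> \<in> lin_maps A"
  shows "lmap_smult A c \<Phi> \<in> lin_maps A"
proof -
  note in1 = lin_mapsD[OF assms]
  have "lmap_smult A c \<Phi> = (\<lambda>X\<in>ops (din A). mat (dout A) (dout A) (\<lambda>(r, s). c * \<Phi> X $$ (r, s)))"
    unfolding lmap_smult_def
  proof (rule restrict_ext)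
    fix X assume "X \<in> ops (din A)"
    from in1(1)[OF this]
    show "c \<cdot>\<^sub>m \<Phi> X = mat (dout A) (dout A) (\<lambda>(r, s). c * \<Phi> X $$ (r, s))"
      by (intro eq_matI) auto
  qed
  also have "\<dots> \<in> lin_maps A"
  proof (rule lin_maps_mat)
    fix X Y r s assume *: "X \<in> ops (din A)" "Y \<in> ops (din A)" "r < dout A" "s < dout A"
    then show "c * \<Phi> (X + Y) $$ (r, s) = c * \<Phi> X $$ (r, s) + c * \<Phi> Y $$ (r, s)"
      using in1(1)[OF *(2)] by (simp add: in1(2) distrib_left)
  next
    fix d X r s assume *: "X \<in> ops (din A)" "r < dout A" "s < dout A"
    then show "c * \<Phi> (d \<cdot>\<^sub>m X) $$ (r, s) = d * (c * \<Phi> X $$ (r, s))"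
      using in1(1)[OF *(1)] by (simp add: in1(3))
  qed
  finally show ?thesis .
qed

lemma unit_map_in [simp]:
  assumes "i < din A" "j < din A"
  shows "unit_map A i j k l \<in> lin_maps A"
proof -
  have "unit_map A i j k l = (\<lambda>X\<in>ops (din A). mat (dout A) (dout A)
      (\<lambda>(r, s). X $$ (i, j) * (if r = k \<and> s = l then 1 else 0)))"
    unfolding unit_map_def by (rule restrict_ext) (auto simp: unit_op_def)
  also have "\<dots> \<in> lin_maps A"
    using assms by (intro lin_maps_mat) (auto simp: distrib_right)
  finally show ?thesis .
qed

definition lincomb :: "party \<Rightarrow> ('t \<Rightarrow> complex) \<Rightarrow> ('t \<Rightarrow> cmap) \<Rightarrow> 't set \<Rightarrow> cmap" where
  "lincomb A c M I = (\<lambda>X\<in>ops (din A). mat (dout A) (dout A) (\<lambda>(r, s). \<Sum>t\<in>I. c t * M t X $$ (r, s)))"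

lemma lincomb_in:
  assumes "\<And>t. t \<in> I \<Longrightarrow> M t \<in> lin_maps A"
  shows "lincomb A c M I \<in> lin_maps A"
  unfolding lincomb_def
proof (rule lin_maps_mat)
  fix X Y r s assume *: "X \<in> ops (din A)" "Y \<in> ops (din A)" "r < dout A" "s < dout A"
  show "(\<Sum>t\<in>I. c t * M t (X + Y) $$ (r, s)) =
      (\<Sum>t\<in>I. c t * M t X $$ (r, s)) + (\<Sum>t\<in>I. c t * M t Y $$ (r, s))"
    unfolding sum.distrib[symmetric]
  proof (rule sum.cong[OF refl])
    fix t assume "t \<in> I"
    note M = lin_mapsD[OF assms[OF this]]
    show "c t * M t (X + Y) $$ (r, s) = c t * M t X $$ (r, s) + c t * M t Y $$ (r, s)"
      unfolding M(2)[OF *(1,2)] using M(1)[OF *(2)] * by (simp add: distrib_left)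
  qed
next
  fix d X r s assume *: "X \<in> ops (din A)" "r < dout A" "s < dout A"
  show "(\<Sum>t\<in>I. c t * M t (d \<cdot>\<^sub>m X) $$ (r, s)) = d * (\<Sum>t\<in>I. c t * M t X $$ (r, s))"
    unfolding sum_distrib_left
  proof (rule sum.cong[OF refl])
    fix t assume "t \<in> I"
    note M = lin_mapsD[OF assms[OF this]]
    show "c t * M t (d \<cdot>\<^sub>m X) $$ (r, s) = d * (c t * M t X $$ (r, s))"
      unfolding M(3)[OF *(1)] using M(1)[OF *(1)] * by simp
  qed
qed

lemma lincomb_insert:
  assumes "finite I" "t \<notin> I" "\<And>u. u \<in> insert t I \<Longrightarrow> M u \<in> lin_maps A"
  shows "lincomb A c M (insert t I) = lmap_add A (lmap_smult A (c t) (M t)) (lincomb A c M I)"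
proof (rule lin_maps_eqI[of _ A])
  show "lincomb A c M (insert t I) \<in> lin_maps A" using assms by (intro lincomb_in)
  show "lmap_add A (lmap_smult A (c t) (M t)) (lincomb A c M I) \<in> lin_maps A"
    using assms by (intro lmap_add_in lmap_smult_in lincomb_in) auto
  fix X r s assume *: "X \<in> ops (din A)" "r < dout A" "s < dout A"
  have "M t X \<in> ops (dout A)" using lin_mapsD(1)[OF assms(3)] * by auto
  then show "lincomb A c M (insert t I) X $$ (r, s) =
      lmap_add A (lmap_smult A (c t) (M t)) (lincomb A c M I) X $$ (r, s)"
    using * assms(1,2) by (auto simp: lincomb_def lmap_add_def lmap_smult_def)
qed

lemma supermap_lincomb:
  assumes \<Theta>: "\<Theta> \<in> supermaps A B" and "finite I" and "\<And>t. t \<in> I \<Longrightarrow> M t \<in> lin_maps A"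
  shows "\<Theta> (lincomb A c M I) = lincomb B c (\<lambda>t. \<Theta> (M t)) I"
  using assms(2,3)
proof (induction I)
  case empty
  have e: "lincomb A c M {} \<in> lin_maps A" by (intro lincomb_in) auto
  have z: "lmap_smult A 0 (lincomb A c M {}) = lincomb A c M {}"
    by (auto simp: lmap_smult_def lincomb_def fun_eq_iff intro!: eq_matI)
  have "\<Theta> (lincomb A c M {}) = lmap_smult B 0 (\<Theta> (lincomb A c M {}))"
    using supermapsD(3)[OF \<Theta> e, of 0] z by simp
  also have "\<dots> = lincomb B c (\<lambda>t. \<Theta> (M t)) {}"
    unfolding lmap_smult_def lincomb_def[of B]
  proof (rule restrict_ext)
    fix X assume "X \<in> ops (din B)"
    from lin_mapsD(1)[OF supermapsD(1)[OF \<Theta> e] this]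
    show "0 \<cdot>\<^sub>m \<Theta> (lincomb A c M {}) X =
        mat (dout B) (dout B) (\<lambda>(r, s). \<Sum>t\<in>{}. c t * \<Theta> (M t) X $$ (r, s))"
      by (intro eq_matI) auto
  qed
  finally show ?case .
next
  case (insert t I)
  have "\<Theta> (lincomb A c M (insert t I)) =
      lmap_add B (lmap_smult B (c t) (\<Theta> (M t))) (\<Theta> (lincomb A c M I))"
    using insert.prems insert.hyps
    by (subst lincomb_insert)
      (auto simp: supermapsD(2)[OF \<Theta>] supermapsD(3)[OF \<Theta>] lmap_smult_in lincomb_in)
  also have "\<dots> = lincomb B c (\<lambda>t. \<Theta> (M t)) (insert t I)"
    using insert by (subst lincomb_insert) (auto intro: supermapsD(1)[OF \<Theta>])
  finally show ?case .
qed

lemma finite_map_idx [simp]: "finite (map_idx A)"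
  by (simp add: map_idx_def)

lemma sum_map_idx:
  "(\<Sum>t\<in>map_idx A. f t) = (\<Sum>i<din A. \<Sum>j<din A. \<Sum>k<dout A. \<Sum>l<dout A. f (i, j, k, l))"
  by (simp add: map_idx_def sum.cartesian_product' )

lemma lin_map_sum:
  assumes "\<Phi> \<in> lin_maps A" "finite T"
  shows "r < dout A \<Longrightarrow> s < dout A \<Longrightarrow>
    \<Phi> (mat (din A) (din A) (\<lambda>(u, v). \<Sum>(i, j)\<in>T. c i j * unit_op (din A) i j $$ (u, v))) $$ (r, s)
    = (\<Sum>(i, j)\<in>T. c i j * \<Phi> (unit_op (din A) i j) $$ (r, s))"
  using assms(2)
proof (induction T)
  case empty
  let ?Z = "mat (din A) (din A) (\<lambda>(u, v). 0) :: complex mat"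
  have "?Z = 0 \<cdot>\<^sub>m ?Z" by (intro eq_matI) auto
  then have "\<Phi> ?Z = 0 \<cdot>\<^sub>m \<Phi> ?Z" using lin_mapsD(3)[OF assms(1), of ?Z 0] by simp
  moreover have "\<Phi> ?Z \<in> ops (dout A)" by (intro lin_mapsD(1)[OF assms(1)]) auto
  ultimately have "\<Phi> ?Z $$ (r, s) = 0"
    using empty by (metis carrier_matD index_smult_mat(1) mult_zero_left)
  then show ?case by (simp add: case_prod_unfold)
next
  case (insert t T)
  obtain i j where t: "t = (i, j)" by force
  let ?E = "unit_op (din A)"
  let ?M = "\<lambda>T. mat (din A) (din A) (\<lambda>(u, v). \<Sum>(i, j)\<in>T. c i j * ?E i j $$ (u, v))"
  have "?M (insert t T) = c i j \<cdot>\<^sub>m ?E i j + ?M T"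
    using insert.hyps by (intro eq_matI) (auto simp: t unit_op_def)
  then have "\<Phi> (?M (insert t T)) = \<Phi> (c i j \<cdot>\<^sub>m ?E i j + ?M T)" by simp
  also have "\<dots> = c i j \<cdot>\<^sub>m \<Phi> (?E i j) + \<Phi> (?M T)"
    by (simp add: lin_mapsD(2,3)[OF assms(1)])
  finally have eq: "\<Phi> (?M (insert t T)) = c i j \<cdot>\<^sub>m \<Phi> (?E i j) + \<Phi> (?M T)" .
  have "\<Phi> (?E i j) \<in> ops (dout A)" "\<Phi> (?M T) \<in> ops (dout A)"
    by (auto intro!: lin_mapsD(1)[OF assms(1)])
  then have "\<Phi> (?M (insert t T)) $$ (r, s) = c i j * \<Phi> (?E i j) $$ (r, s) + \<Phi> (?M T) $$ (r, s)"
    unfolding eq using insert.prems by simp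
  also have "\<dots> = (\<Sum>(i, j)\<in>insert t T. c i j * \<Phi> (?E i j) $$ (r, s))"
    using insert.hyps insert.IH[OF insert.prems] by (simp add: t case_prod_unfold)
  finally show ?case .
qed

lemma lin_map_expand:
  assumes "\<Phi> \<in> lin_maps A" "X \<in> ops (din A)" "r < dout A" "s < dout A"
  shows "\<Phi> X $$ (r, s) = (\<Sum>i<din A. \<Sum>j<din A. X $$ (i, j) * \<Phi> (unit_op (din A) i j) $$ (r, s))"
proof -
  let ?T = "{..<din A} \<times> {..<din A}"
  have "X = mat (din A) (din A) (\<lambda>(u, v). \<Sum>(i, j)\<in>?T. X $$ (i, j) * unit_op (din A) i j $$ (u, v))"
    (is "_ = ?M")
  proof (rule eq_matI)
    fix u v assume "u < dim_row ?M" "v < dim_col ?M"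
    then have uv: "u < din A" "v < din A" by auto
    have "(\<Sum>(i, j)\<in>?T. X $$ (i, j) * unit_op (din A) i j $$ (u, v)) =
        (\<Sum>t\<in>?T. if t = (u, v) then X $$ (u, v) else 0)"
      using uv by (intro sum.cong) (auto simp: unit_op_def split: if_splits)
    also have "\<dots> = X $$ (u, v)" using uv by simp
    finally show "X $$ (u, v) = ?M $$ (u, v)" using uv by simp
  qed (use assms(2) in auto)
  then have "\<Phi> X $$ (r, s) = \<Phi> ?M $$ (r, s)" by (rule arg_cong)
  also have "\<dots> = (\<Sum>(i, j)\<in>?T. X $$ (i, j) * \<Phi> (unit_op (din A) i j) $$ (r, s))"
    using assms by (subst lin_map_sum) auto
  finally show ?thesis by (simp add: sum.cartesian_product)
qed

lemma map_expand:
  assumes "\<Phi> \<in> lin_maps A"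
  shows "\<Phi> = lincomb A (\<lambda>(i, j, k, l). \<Phi> (unit_op (din A) i j) $$ (k, l))
    (\<lambda>(i, j, k, l). unit_map A i j k l) (map_idx A)" (is "_ = ?R")
proof (rule lin_maps_eqI[OF assms])
  show "?R \<in> lin_maps A" by (intro lincomb_in) (auto simp: map_idx_def)
  fix X r s assume *: "X \<in> ops (din A)" "r < dout A" "s < dout A"
  have "?R X $$ (r, s) = (\<Sum>i<din A. \<Sum>j<din A. \<Sum>k<dout A. \<Sum>l<dout A.
      \<Phi> (unit_op (din A) i j) $$ (k, l) * unit_map A i j k l X $$ (r, s))"
    using * by (simp add: lincomb_def sum_map_idx)
  also have "\<dots> = (\<Sum>i<din A. \<Sum>j<din A. \<Sum>k<dout A. \<Sum>l<dout A.
      if l = s then (if k = r then X $$ (i, j) * \<Phi> (unit_op (din A) i j) $$ (r, s) else 0) else 0)"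
    using * by (intro sum.cong refl) (auto simp: unit_map_def unit_op_def)
  also have "\<dots> = \<Phi> X $$ (r, s)"
    using * by (simp add: lin_map_expand[OF assms *])
  finally show "\<Phi> X $$ (r, s) = ?R X $$ (r, s)" by simp
qed

lemma supermap_expand:
  assumes "\<Theta> \<in> supermaps A B" "\<Phi> \<in> lin_maps A" "X \<in> ops (din B)" "r < dout B" "s < dout B"
  shows "\<Theta> \<Phi> X $$ (r, s) = (\<Sum>(i, j, k, l)\<in>map_idx A.
    \<Phi> (unit_op (din A) i j) $$ (k, l) * \<Theta> (unit_map A i j k l) X $$ (r, s))"
proof -
  have "\<Theta> \<Phi> = lincomb B (\<lambda>(i, j, k, l). \<Phi> (unit_op (din A) i j) $$ (k, l))
      (\<lambda>t. \<Theta> ((\<lambda>(i, j, k, l). unit_map A i j k l) t)) (map_idx A)"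
    by (subst map_expand[OF assms(2)], rule supermap_lincomb[OF assms(1)]) (auto simp: map_idx_def)
  then show ?thesis using assms by (simp add: lincomb_def case_prod_unfold)
qed

text \<open>The tensor product of linear maps.\<close>

lemma map_tensor_in: "map_tensor A C f g \<in> lin_maps (A \<otimes>\<^sub>P C)"
proof -
  have "(\<lambda>X\<in>ops (din (A \<otimes>\<^sub>P C)). mat (dout (A \<otimes>\<^sub>P C)) (dout (A \<otimes>\<^sub>P C)) (\<lambda>(r, s).
       \<Sum>i<din A. \<Sum>j<din A. \<Sum>k<din C. \<Sum>l<din C.
         X $$ (i * din C + k, j * din C + l) *
         (f (unit_op (din A) i j) \<otimes>\<^sub>M g (unit_op (din C) k l)) $$ (r, s))) \<in> lin_maps (A \<otimes>\<^sub>P C)"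
    by (rule lin_maps_mat)
      (auto simp: party_tensor_def index_less distrib_right sum.distrib sum_distrib_left mult.assoc)
  then show ?thesis by (simp add: map_tensor_def party_tensor_def)
qed

lemma map_tensor_index:
  assumes "f \<in> lin_maps A" "g \<in> lin_maps C" "X \<in> ops (din A * din C)"
    and "r < dout A * dout C" "s < dout A * dout C"
  shows "map_tensor A C f g X $$ (r, s) =
    (\<Sum>i<din A. \<Sum>j<din A. \<Sum>k<din C. \<Sum>l<din C. X $$ (i * din C + k, j * din C + l) *
       (f (unit_op (din A) i j) $$ (r div dout C, s div dout C) *
        g (unit_op (din C) k l) $$ (r mod dout C, s mod dout C)))"
  using assms(3-5)
  by (simp add: map_tensor_def mat_tensor_index[OF lin_mapsD(1)[OF assms(1)] lin_mapsD(1)[OF assms(2)]])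

lemma sum_product4:
  fixes f g :: "nat \<Rightarrow> nat \<Rightarrow> 'a :: comm_semiring_0"
  shows "(\<Sum>i<a. \<Sum>j<a. \<Sum>k<c. \<Sum>l<c. f i j * g k l) = (\<Sum>i<a. \<Sum>j<a. f i j) * (\<Sum>k<c. \<Sum>l<c. g k l)"
  unfolding sum_distrib_right unfolding sum_distrib_left ..

lemma map_tensor_mat_tensor:
  assumes f: "f \<in> lin_maps A" and g: "g \<in> lin_maps C" and X: "X \<in> ops (din A)" and Y: "Y \<in> ops (din C)"
  shows "map_tensor A C f g (X \<otimes>\<^sub>M Y) = f X \<otimes>\<^sub>M g Y"
proof (rule eq_matI)
  have c: "f X \<otimes>\<^sub>M g Y \<in> ops (dout A * dout C)"
    using assms by (simp add: lin_mapsD(1))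
  have "map_tensor A C f g (X \<otimes>\<^sub>M Y) \<in> ops (dout A * dout C)"
    using assms by (auto simp: map_tensor_def)
  then show "dim_row (map_tensor A C f g (X \<otimes>\<^sub>M Y)) = dim_row (f X \<otimes>\<^sub>M g Y)"
    "dim_col (map_tensor A C f g (X \<otimes>\<^sub>M Y)) = dim_col (f X \<otimes>\<^sub>M g Y)" using c by auto
  fix r s assume "r < dim_row (f X \<otimes>\<^sub>M g Y)" "s < dim_col (f X \<otimes>\<^sub>M g Y)"
  then have rs: "r < dout A * dout C" "s < dout A * dout C" using c by auto
  note b = div_less_dim[OF rs(1)] div_less_dim[OF rs(2)] mod_less_dim[OF rs(1)] mod_less_dim[OF rs(2)]
  have "map_tensor A C f g (X \<otimes>\<^sub>M Y) $$ (r, s) = (\<Sum>i<din A. \<Sum>j<din A. \<Sum>k<din C. \<Sum>l<din C.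
       (X $$ (i, j) * f (unit_op (din A) i j) $$ (r div dout C, s div dout C)) *
       (Y $$ (k, l) * g (unit_op (din C) k l) $$ (r mod dout C, s mod dout C)))"
    using X Y rs by (subst map_tensor_index[OF f g])
      (auto intro!: sum.cong simp: mat_tensor_index'[OF X Y])
  also have "\<dots> = f X $$ (r div dout C, s div dout C) * g Y $$ (r mod dout C, s mod dout C)"
    by (subst sum_product4) (simp add: lin_map_expand[OF f X b(1,2)] lin_map_expand[OF g Y b(3,4)])
  also have "\<dots> = (f X \<otimes>\<^sub>M g Y) $$ (r, s)"
    using rs by (simp add: mat_tensor_index[OF lin_mapsD(1)[OF f X] lin_mapsD(1)[OF g Y]])
  finally show "map_tensor A C f g (X \<otimes>\<^sub>M Y) $$ (r, s) = (f X \<otimes>\<^sub>M g Y) $$ (r, s)" .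
qed

lemma sum_rotate:
  "(\<Sum>a\<in>S. \<Sum>c\<in>T. \<Sum>x\<in>J. h a c x) = (\<Sum>x\<in>J. \<Sum>a\<in>S. \<Sum>c\<in>T. (h a c x :: 'a :: comm_monoid_add))"
proof -
  have "(\<Sum>c\<in>T. \<Sum>x\<in>J. h a c x) = (\<Sum>x\<in>J. \<Sum>c\<in>T. h a c x)" for a
    by (rule sum.swap)
  then show ?thesis by (simp only:) (rule sum.swap)
qed

text \<open>The tensor product of supermaps.\<close>

lemma supermap_tensor_in:
  assumes "\<Theta> \<in> supermaps A B" "\<Xi> \<in> supermaps C D"
  shows "supermap_tensor A B C D \<Theta> \<Xi> \<in> supermaps (A \<otimes>\<^sub>P C) (B \<otimes>\<^sub>P D)"
proof -
  let ?c = "\<lambda>\<Gamma> ((i, j, k, l), (m, n, p, q)).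
    \<Gamma> (unit_op (din A) i j \<otimes>\<^sub>M unit_op (din C) m n) $$ (k * dout C + p, l * dout C + q)"
  let ?M = "\<lambda>((i, j, k, l), (m, n, p, q)).
    map_tensor B D (\<Theta> (unit_map A i j k l)) (\<Xi> (unit_map C m n p q))"
  let ?I = "map_idx A \<times> map_idx C"
  have eq: "supermap_tensor A B C D \<Theta> \<Xi> \<Gamma> = lincomb (B \<otimes>\<^sub>P D) (?c \<Gamma>) ?M ?I"
    if "\<Gamma> \<in> lin_maps (A \<otimes>\<^sub>P C)" for \<Gamma>
    using that by (simp add: supermap_tensor_def lincomb_def party_tensor_def sum.cartesian_product
        case_prod_unfold)
  have M: "?M t \<in> lin_maps (B \<otimes>\<^sub>P D)" for t by (simp add: map_tensor_in case_prod_unfold)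
  have E: "unit_op (din A) i j \<otimes>\<^sub>M unit_op (din C) m n \<in> ops (din (A \<otimes>\<^sub>P C))" for i j m n
    by (simp add: party_tensor_def)
  have L: "lincomb (B \<otimes>\<^sub>P D) c ?M ?I \<in> lin_maps (B \<otimes>\<^sub>P D)" for c
    using M by (intro lincomb_in)
  have add: "lincomb (B \<otimes>\<^sub>P D) (?c (lmap_add (A \<otimes>\<^sub>P C) \<Gamma> \<Delta>)) ?M ?I =
      lmap_add (B \<otimes>\<^sub>P D) (lincomb (B \<otimes>\<^sub>P D) (?c \<Gamma>) ?M ?I) (lincomb (B \<otimes>\<^sub>P D) (?c \<Delta>) ?M ?I)"
    if G: "\<Gamma> \<in> lin_maps (A \<otimes>\<^sub>P C)" and H: "\<Delta> \<in> lin_maps (A \<otimes>\<^sub>P C)" for \<Gamma> \<Delta>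
  proof -
    have "?c (lmap_add (A \<otimes>\<^sub>P C) \<Gamma> \<Delta>) t = ?c \<Gamma> t + ?c \<Delta> t" if "t \<in> ?I" for t
      using that E carrier_matD[OF lin_mapsD(1)[OF G E]] carrier_matD[OF lin_mapsD(1)[OF H E]]
      by (auto simp: lmap_add_def map_idx_def party_tensor_def index_less)
    then show ?thesis
      by (auto simp: lincomb_def lmap_add_def fun_eq_iff distrib_right sum.distrib intro!: eq_matI)
  qed
  have smult: "lincomb (B \<otimes>\<^sub>P D) (?c (lmap_smult (A \<otimes>\<^sub>P C) d \<Gamma>)) ?M ?I =
      lmap_smult (B \<otimes>\<^sub>P D) d (lincomb (B \<otimes>\<^sub>P D) (?c \<Gamma>) ?M ?I)"
    if G: "\<Gamma> \<in> lin_maps (A \<otimes>\<^sub>P C)" for \<Gamma> d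
  proof -
    have "?c (lmap_smult (A \<otimes>\<^sub>P C) d \<Gamma>) t = d * ?c \<Gamma> t" if "t \<in> ?I" for t
      using that E carrier_matD[OF lin_mapsD(1)[OF G E]]
      by (auto simp: lmap_smult_def map_idx_def party_tensor_def index_less)
    then show ?thesis
      by (auto simp: lincomb_def lmap_smult_def fun_eq_iff sum_distrib_left mult.assoc intro!: eq_matI)
  qed
  show ?thesis
    unfolding supermaps_def
  proof (intro CollectI conjI ballI allI PiE_I)
    fix \<Gamma> assume "\<Gamma> \<notin> lin_maps (A \<otimes>\<^sub>P C)"
    then show "supermap_tensor A B C D \<Theta> \<Xi> \<Gamma> = undefined"
      by (simp add: supermap_tensor_def)
  qed (use L in \<open>simp_all only: eq lmap_add_in lmap_smult_in add smult\<close>)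
qed

lemma supermap_tensor_map_tensor:
  assumes \<Theta>: "\<Theta> \<in> supermaps A B" and \<Xi>: "\<Xi> \<in> supermaps C D"
    and \<Phi>: "\<Phi> \<in> lin_maps A" and \<Psi>: "\<Psi> \<in> lin_maps C"
  shows "supermap_tensor A B C D \<Theta> \<Xi> (map_tensor A C \<Phi> \<Psi>) = map_tensor B D (\<Theta> \<Phi>) (\<Xi> \<Psi>)"
proof (rule lin_maps_eqI)
  show "map_tensor B D (\<Theta> \<Phi>) (\<Xi> \<Psi>) \<in> lin_maps (B \<otimes>\<^sub>P D)" by (rule map_tensor_in)
  show "supermap_tensor A B C D \<Theta> \<Xi> (map_tensor A C \<Phi> \<Psi>) \<in> lin_maps (B \<otimes>\<^sub>P D)"
    by (intro supermapsD(1)[OF supermap_tensor_in[OF \<Theta> \<Xi>]] map_tensor_in)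
  fix X r s
  assume "X \<in> ops (din (B \<otimes>\<^sub>P D))" "r < dout (B \<otimes>\<^sub>P D)" "s < dout (B \<otimes>\<^sub>P D)"
  then have X: "X \<in> ops (din B * din D)" and rs: "r < dout B * dout D" "s < dout B * dout D"
    by (auto simp: party_tensor_def)
  note b = div_less_dim[OF rs(1)] div_less_dim[OF rs(2)] mod_less_dim[OF rs(1)] mod_less_dim[OF rs(2)]
  define \<phi> where "\<phi> = (\<lambda>(i, j, k, l). \<Phi> (unit_op (din A) i j) $$ (k, l))"
  define \<psi> where "\<psi> = (\<lambda>(i, j, k, l). \<Psi> (unit_op (din C) i j) $$ (k, l))"
  define F where "F = (\<lambda>(i, j, k, l) u v. \<Theta> (unit_map A i j k l) (unit_op (din B) u v) $$ (r div dout D, s div dout D))"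
  define G where "G = (\<lambda>(i, j, k, l) u v. \<Xi> (unit_map C i j k l) (unit_op (din D) u v) $$ (r mod dout D, s mod dout D))"
  define J where "J = {..<din B} \<times> {..<din B} \<times> {..<din D} \<times> {..<din D}"
  have cf: "map_tensor A C \<Phi> \<Psi> (unit_op (din A) i j \<otimes>\<^sub>M unit_op (din C) m n) $$
      (k * dout C + p, l * dout C + q) = \<phi> (i, j, k, l) * \<psi> (m, n, p, q)"
    if "(i, j, k, l) \<in> map_idx A" "(m, n, p, q) \<in> map_idx C" for i j k l m n p q
    using that mat_tensor_index'[OF lin_mapsD(1)[OF \<Phi> unit_op_carrier] lin_mapsD(1)[OF \<Psi> unit_op_carrier]]
    by (simp add: map_tensor_mat_tensor[OF \<Phi> \<Psi>] \<phi>_def \<psi>_def map_idx_def)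
  have mt: "map_tensor B D (\<Theta> (unit_map A i j k l)) (\<Xi> (unit_map C m n p q)) X $$ (r, s) =
      (\<Sum>(u, v, w, z)\<in>J. X $$ (u * din D + w, v * din D + z) *
        (F (i, j, k, l) u v * G (m, n, p, q) w z))"
    if "(i, j, k, l) \<in> map_idx A" "(m, n, p, q) \<in> map_idx C" for i j k l m n p q
  proof -
    have "\<Theta> (unit_map A i j k l) \<in> lin_maps B" "\<Xi> (unit_map C m n p q) \<in> lin_maps D"
      using that by (auto intro: supermapsD(1)[OF \<Theta>] supermapsD(1)[OF \<Xi>] simp: map_idx_def)
    then show ?thesis
      by (simp add: map_tensor_index[OF _ _ X rs] F_def G_def J_def sum.cartesian_product')
  qed
  have "supermap_tensor A B C D \<Theta> \<Xi> (map_tensor A C \<Phi> \<Psi>) X $$ (r, s) =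
      (\<Sum>a\<in>map_idx A. \<Sum>c\<in>map_idx C. (\<phi> a * \<psi> c) *
        (\<Sum>(u, v, w, z)\<in>J. X $$ (u * din D + w, v * din D + z) * (F a u v * G c w z)))"
    using X rs
    by (simp add: supermap_tensor_def map_tensor_in) (auto simp: cf mt intro!: sum.cong)
  also have "\<dots> = (\<Sum>a\<in>map_idx A. \<Sum>c\<in>map_idx C. \<Sum>(u, v, w, z)\<in>J.
      X $$ (u * din D + w, v * din D + z) * ((\<phi> a * F a u v) * (\<psi> c * G c w z)))"
    by (simp add: sum_distrib_left case_prod_unfold mult.assoc mult.left_commute)
  also have "\<dots> = (\<Sum>(u, v, w, z)\<in>J. \<Sum>a\<in>map_idx A. \<Sum>c\<in>map_idx C.
      X $$ (u * din D + w, v * din D + z) * ((\<phi> a * F a u v) * (\<psi> c * G c w z)))"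
    unfolding case_prod_unfold by (rule sum_rotate)
  also have "\<dots> = (\<Sum>(u, v, w, z)\<in>J. X $$ (u * din D + w, v * din D + z) *
      ((\<Sum>a\<in>map_idx A. \<phi> a * F a u v) * (\<Sum>c\<in>map_idx C. \<psi> c * G c w z)))"
    unfolding sum_product unfolding sum_distrib_left ..
  also have "\<dots> = (\<Sum>(u, v, w, z)\<in>J. X $$ (u * din D + w, v * din D + z) *
      (\<Theta> \<Phi> (unit_op (din B) u v) $$ (r div dout D, s div dout D) *
       \<Xi> \<Psi> (unit_op (din D) w z) $$ (r mod dout D, s mod dout D)))"
    by (simp add: supermap_expand[OF \<Theta> \<Phi> unit_op_carrier b(1,2)]
        supermap_expand[OF \<Xi> \<Psi> unit_op_carrier b(3,4)] \<phi>_def \<psi>_def F_def G_def case_prod_unfold)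
  also have "\<dots> = map_tensor B D (\<Theta> \<Phi>) (\<Xi> \<Psi>) X $$ (r, s)"
    using X rs supermapsD(1)[OF \<Theta> \<Phi>] supermapsD(1)[OF \<Xi> \<Psi>]
    by (simp add: map_tensor_index J_def sum.cartesian_product')
  finally show "supermap_tensor A B C D \<Theta> \<Xi> (map_tensor A C \<Phi> \<Psi>) X $$ (r, s) =
      map_tensor B D (\<Theta> \<Phi>) (\<Xi> \<Psi>) X $$ (r, s)" .
qed

text \<open>The dual.\<close>

lemma map_inner_alt:
  assumes "\<Phi> \<in> lin_maps A" "\<Psi> \<in> lin_maps A"
  shows "map_inner A \<Phi> \<Psi> = (\<Sum>(i, j, k, l)\<in>map_idx A.
    cnj (\<Phi> (unit_op (din A) i j) $$ (k, l)) * \<Psi> (unit_op (din A) i j) $$ (k, l))"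
proof -
  have "trace (mat_adjoint X * Y) = (\<Sum>k<d. \<Sum>l<d. cnj (X $$ (k, l)) * Y $$ (k, l))"
    if "X \<in> ops d" "Y \<in> ops d" for X Y d
  proof -
    have "mat_adjoint X \<in> ops d" using that by (auto simp: mat_adjoint_def)
    then have "trace (mat_adjoint X * Y) = (\<Sum>l<d. \<Sum>k<d. cnj (X $$ (k, l)) * Y $$ (k, l))"
      using that by (auto simp: trace_def scalar_prod_def mat_adjoint_def mat_of_rows_def
          atLeast0LessThan intro!: sum.cong)
    then show ?thesis by (subst sum.swap)
  qed
  from this[OF lin_mapsD(1)[OF assms(1)] lin_mapsD(1)[OF assms(2)]]
  show ?thesis by (simp add: map_inner_def sum_map_idx)
qed

lemma map_inner_add:
  assumes "\<Phi> \<in> lin_maps A" "\<Psi> \<in> lin_maps A" "\<Psi>' \<in> lin_maps A"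
  shows "map_inner A \<Phi> (lmap_add A \<Psi> \<Psi>') = map_inner A \<Phi> \<Psi> + map_inner A \<Phi> \<Psi>'"
proof -
  have "lmap_add A \<Psi> \<Psi>' (unit_op (din A) i j) $$ (k, l) =
      \<Psi> (unit_op (din A) i j) $$ (k, l) + \<Psi>' (unit_op (din A) i j) $$ (k, l)"
    if "(i, j, k, l) \<in> map_idx A" for i j k l
    using that lin_mapsD(1)[OF assms(3) unit_op_carrier[of "din A" i j]]
    by (simp add: lmap_add_def map_idx_def)
  then show ?thesis
    unfolding map_inner_alt[OF assms(1) lmap_add_in[OF assms(2,3)]] map_inner_alt[OF assms(1,2)]
      map_inner_alt[OF assms(1,3)] sum.distrib[symmetric]
    by (intro sum.cong refl) (auto simp: distrib_left)
qed

lemma map_inner_smult: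
  assumes "\<Phi> \<in> lin_maps A" "\<Psi> \<in> lin_maps A"
  shows "map_inner A \<Phi> (lmap_smult A c \<Psi>) = c * map_inner A \<Phi> \<Psi>"
proof -
  have "lmap_smult A c \<Psi> (unit_op (din A) i j) $$ (k, l) = c * \<Psi> (unit_op (din A) i j) $$ (k, l)"
    if "(i, j, k, l) \<in> map_idx A" for i j k l
    using that lin_mapsD(1)[OF assms(2) unit_op_carrier[of "din A" i j]]
    by (simp add: lmap_smult_def map_idx_def)
  then show ?thesis
    unfolding map_inner_alt[OF assms(1) lmap_smult_in[OF assms(2)]] map_inner_alt[OF assms(1,2)]
      sum_distrib_left
    by (intro sum.cong refl) auto
qed

lemma map_inner_unit_map:
  assumes "(i, j, k, l) \<in> map_idx A" "\<Psi> \<in> lin_maps A"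
  shows "map_inner A (unit_map A i j k l) \<Psi> = \<Psi> (unit_op (din A) i j) $$ (k, l)"
proof -
  have "map_inner A (unit_map A i j k l) \<Psi> = (\<Sum>t\<in>map_idx A.
      if t = (i, j, k, l) then \<Psi> (unit_op (din A) i j) $$ (k, l) else 0)"
  proof (subst map_inner_alt)
    show "unit_map A i j k l \<in> lin_maps A" using assms by (simp add: map_idx_def)
    show "(\<Sum>(i', j', k', l')\<in>map_idx A. cnj (unit_map A i j k l (unit_op (din A) i' j') $$ (k', l')) *
        \<Psi> (unit_op (din A) i' j') $$ (k', l')) = (\<Sum>t\<in>map_idx A.
        if t = (i, j, k, l) then \<Psi> (unit_op (din A) i j) $$ (k, l) else 0)"
    proof (rule sum.cong[OF refl], clarify)
      fix i' j' k' l' assume "(i', j', k', l') \<in> map_idx A"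
      then have "unit_map A i j k l (unit_op (din A) i' j') $$ (k', l') =
          (if (i', j', k', l') = (i, j, k, l) then 1 else 0)"
        using assms(1) by (auto simp: map_idx_def unit_map_def unit_op_def)
      then show "cnj (unit_map A i j k l (unit_op (din A) i' j') $$ (k', l')) *
          \<Psi> (unit_op (din A) i' j') $$ (k', l') =
          (if (i', j', k', l') = (i, j, k, l) then \<Psi> (unit_op (din A) i j) $$ (k, l) else 0)"
        by simp
    qed
  qed (rule assms(2))
  then show ?thesis using assms by simp
qed

lemma map_inner_expand:
  assumes "\<Theta> \<in> supermaps A B" "\<Phi> \<in> lin_maps A" "\<Psi> \<in> lin_maps B"
  shows "map_inner B (\<Theta> \<Phi>) \<Psi> = (\<Sum>(i, j, k, l)\<in>map_idx A.
    cnj (\<Phi> (unit_op (din A) i j) $$ (k, l)) * map_inner B (\<Theta> (unit_map A i j k l)) \<Psi>)"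
proof -
  have "map_inner B (\<Theta> \<Phi>) \<Psi> = (\<Sum>(m, n, p, q)\<in>map_idx B. (\<Sum>(i, j, k, l)\<in>map_idx A.
      cnj (\<Phi> (unit_op (din A) i j) $$ (k, l)) * cnj (\<Theta> (unit_map A i j k l) (unit_op (din B) m n) $$ (p, q)))
      * \<Psi> (unit_op (din B) m n) $$ (p, q))"
    unfolding map_inner_alt[OF supermapsD(1)[OF assms(1,2)] assms(3)]
  proof (rule sum.cong[OF refl], clarify)
    fix m n p q assume "(m, n, p, q) \<in> map_idx B"
    then have pq: "p < dout B" "q < dout B" by (auto simp: map_idx_def)
    show "cnj (\<Theta> \<Phi> (unit_op (din B) m n) $$ (p, q)) * \<Psi> (unit_op (din B) m n) $$ (p, q) =
        (\<Sum>(i, j, k, l)\<in>map_idx A. cnj (\<Phi> (unit_op (din A) i j) $$ (k, l)) *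
          cnj (\<Theta> (unit_map A i j k l) (unit_op (din B) m n) $$ (p, q))) *
        \<Psi> (unit_op (din B) m n) $$ (p, q)"
      unfolding supermap_expand[OF assms(1,2) unit_op_carrier pq] by (simp add: case_prod_unfold)
  qed
  also have "\<dots> = (\<Sum>(i, j, k, l)\<in>map_idx A. cnj (\<Phi> (unit_op (din A) i j) $$ (k, l)) *
      (\<Sum>(m, n, p, q)\<in>map_idx B. cnj (\<Theta> (unit_map A i j k l) (unit_op (din B) m n) $$ (p, q))
      * \<Psi> (unit_op (din B) m n) $$ (p, q)))"
    by (simp add: sum_distrib_left sum_distrib_right case_prod_unfold mult.assoc)
      (rule sum.swap)
  also have "\<dots> = (\<Sum>(i, j, k, l)\<in>map_idx A.
    cnj (\<Phi> (unit_op (din A) i j) $$ (k, l)) * map_inner B (\<Theta> (unit_map A i j k l)) \<Psi>)"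
  proof (rule sum.cong[OF refl], clarify)
    fix i j k l assume "(i, j, k, l) \<in> map_idx A"
    then have "\<Theta> (unit_map A i j k l) \<in> lin_maps B"
      by (intro supermapsD(1)[OF assms(1)]) (auto simp: map_idx_def)
    from map_inner_alt[OF this assms(3)]
    show "cnj (\<Phi> (unit_op (din A) i j) $$ (k, l)) *
        (\<Sum>(m, n, p, q)\<in>map_idx B. cnj (\<Theta> (unit_map A i j k l) (unit_op (din B) m n) $$ (p, q)) *
          \<Psi> (unit_op (din B) m n) $$ (p, q)) =
        cnj (\<Phi> (unit_op (din A) i j) $$ (k, l)) * map_inner B (\<Theta> (unit_map A i j k l)) \<Psi>"
      by simp
  qed
  finally show ?thesis .
qed

lemma ex1_dual_supermap:
  assumes \<Theta>: "\<Theta> \<in> supermaps A B"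
  shows "\<exists>!\<Lambda>. \<Lambda> \<in> supermaps B A \<and>
    (\<forall>\<Phi>\<in>lin_maps A. \<forall>\<Psi>\<in>lin_maps B. map_inner A \<Phi> (\<Lambda> \<Psi>) = map_inner B (\<Theta> \<Phi>) \<Psi>)"
proof (rule ex_ex1I)
  define c where "c \<Psi> = (\<lambda>(i, j, k, l). map_inner B (\<Theta> (unit_map A i j k l)) \<Psi>)" for \<Psi>
  let ?U = "\<lambda>(i, j, k, l). unit_map A i j k l"
  define \<Lambda> where "\<Lambda> = (\<lambda>\<Psi>\<in>lin_maps B. lincomb A (c \<Psi>) ?U (map_idx A))"
  have L: "lincomb A d ?U (map_idx A) \<in> lin_maps A" for d
    by (intro lincomb_in) (auto simp: map_idx_def)
  have coeff: "lincomb A d ?U (map_idx A) (unit_op (din A) i j) $$ (k, l) = d (i, j, k, l)"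
    if "(i, j, k, l) \<in> map_idx A" for d i j k l
  proof -
    have "lincomb A d ?U (map_idx A) (unit_op (din A) i j) $$ (k, l) =
        (\<Sum>t\<in>map_idx A. d t * ?U t (unit_op (din A) i j) $$ (k, l))"
      using that by (simp add: lincomb_def map_idx_def)
    also have "\<dots> = (\<Sum>t\<in>map_idx A. if t = (i, j, k, l) then d t else 0)"
    proof (rule sum.cong[OF refl])
      fix t assume "t \<in> map_idx A"
      then show "d t * ?U t (unit_op (din A) i j) $$ (k, l) = (if t = (i, j, k, l) then d t else 0)"
        using that by (cases t) (auto simp: unit_map_def unit_op_def map_idx_def)
    qed
    finally show ?thesis using that by simp
  qed
  have T: "\<Theta> (unit_map A i j k l) \<in> lin_maps B" if "(i, j, k, l) \<in> map_idx A" for i j k l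
    using that by (auto intro: supermapsD(1)[OF \<Theta>] simp: map_idx_def)
  have add: "c (lmap_add B \<Psi> \<Psi>') t = c \<Psi> t + c \<Psi>' t"
    if "\<Psi> \<in> lin_maps B" "\<Psi>' \<in> lin_maps B" "t \<in> map_idx A" for \<Psi> \<Psi>' t
    using that by (cases t) (simp add: c_def map_inner_add T)
  have smult: "c (lmap_smult B d \<Psi>) t = d * c \<Psi> t"
    if "\<Psi> \<in> lin_maps B" "t \<in> map_idx A" for \<Psi> d t
    using that by (cases t) (simp add: c_def map_inner_smult T)
  have "\<Lambda> \<in> supermaps B A"
    unfolding supermaps_def
  proof (intro CollectI conjI ballI allI PiE_I)
    fix \<Psi> \<Psi>' assume P: "\<Psi> \<in> lin_maps B" "\<Psi>' \<in> lin_maps B"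
    then show "\<Lambda> (lmap_add B \<Psi> \<Psi>') = lmap_add A (\<Lambda> \<Psi>) (\<Lambda> \<Psi>')"
      by (auto simp: \<Lambda>_def lmap_add_in add lincomb_def lmap_add_def[of A] fun_eq_iff distrib_right
          sum.distrib intro!: eq_matI)
  next
    fix d \<Psi> assume P: "\<Psi> \<in> lin_maps B"
    then show "\<Lambda> (lmap_smult B d \<Psi>) = lmap_smult A d (\<Lambda> \<Psi>)"
      by (auto simp: \<Lambda>_def lmap_smult_in smult lincomb_def lmap_smult_def[of A] fun_eq_iff mult.assoc
          sum_distrib_left intro!: eq_matI)
  qed (auto simp: \<Lambda>_def L)
  moreover have "map_inner A \<Phi> (\<Lambda> \<Psi>) = map_inner B (\<Theta> \<Phi>) \<Psi>"
    if P: "\<Phi> \<in> lin_maps A" "\<Psi> \<in> lin_maps B" for \<Phi> \<Psi>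
  proof -
    have "map_inner A \<Phi> (\<Lambda> \<Psi>) = (\<Sum>(i, j, k, l)\<in>map_idx A.
        cnj (\<Phi> (unit_op (din A) i j) $$ (k, l)) * c \<Psi> (i, j, k, l))"
      using P by (auto simp: \<Lambda>_def map_inner_alt L coeff intro!: sum.cong)
    then show ?thesis by (simp add: map_inner_expand[OF \<Theta> P] c_def)
  qed
  ultimately show "\<exists>\<Lambda>. \<Lambda> \<in> supermaps B A \<and>
      (\<forall>\<Phi>\<in>lin_maps A. \<forall>\<Psi>\<in>lin_maps B. map_inner A \<Phi> (\<Lambda> \<Psi>) = map_inner B (\<Theta> \<Phi>) \<Psi>)" by blast
next
  fix \<Lambda> \<Lambda>'
  assume 1: "\<Lambda> \<in> supermaps B A \<and>
      (\<forall>\<Phi>\<in>lin_maps A. \<forall>\<Psi>\<in>lin_maps B. map_inner A \<Phi> (\<Lambda> \<Psi>) = map_inner B (\<Theta> \<Phi>) \<Psi>)"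
    and 2: "\<Lambda>' \<in> supermaps B A \<and>
      (\<forall>\<Phi>\<in>lin_maps A. \<forall>\<Psi>\<in>lin_maps B. map_inner A \<Phi> (\<Lambda>' \<Psi>) = map_inner B (\<Theta> \<Phi>) \<Psi>)"
  show "\<Lambda> = \<Lambda>'"
  proof (rule extensionalityI)
    show "\<Lambda> \<in> extensional (lin_maps B)" "\<Lambda>' \<in> extensional (lin_maps B)"
      using 1 2 supermapsD(4) by blast+
    fix \<Psi> assume P: "\<Psi> \<in> lin_maps B"
    have in1: "\<Lambda> \<Psi> \<in> lin_maps A" and in2: "\<Lambda>' \<Psi> \<in> lin_maps A"
      using 1 2 P supermapsD(1) by blast+
    have "\<Lambda> \<Psi> (unit_op (din A) i j) $$ (k, l) = \<Lambda>' \<Psi> (unit_op (din A) i j) $$ (k, l)"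
      if t: "(i, j, k, l) \<in> map_idx A" for i j k l
    proof -
      have "unit_map A i j k l \<in> lin_maps A" using t by (simp add: map_idx_def)
      then show ?thesis
        using 1 2 P map_inner_unit_map[OF t in1] map_inner_unit_map[OF t in2] by metis
    qed
    note eq = this
    show "\<Lambda> \<Psi> = \<Lambda>' \<Psi>"
    proof (intro lin_maps_eqI[OF in1 in2])
      fix X r s assume *: "X \<in> ops (din A)" "r < dout A" "s < dout A"
      show "\<Lambda> \<Psi> X $$ (r, s) = \<Lambda>' \<Psi> X $$ (r, s)"
        unfolding lin_map_expand[OF in1 *] lin_map_expand[OF in2 *]
        using * eq by (intro sum.cong refl) (auto simp: map_idx_def)
    qed
  qed
qed

end

theory Submission
  imports Defs
begin

text \<open>
  Since \<open>\<Theta>\<^sup>*\<close> preserves trace preservation, it maps the space of trace-annihilating maps, which are the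
  differences of trace-preserving ones, to itself. The orthogonal complement of that space consists of the maps
  \<open>X \<mapsto> \<lambda>(X) u\<close>, so \<open>\<Theta>\<close> preserves this form. It is the form of every slice
  \<open>X \<mapsto> \<langle>p|\<Phi>(X \<otimes> |m\<rangle>\<langle>n|)|q\<rangle>\<close> of a marginally uniform \<open>\<Phi>\<close>, and \<open>\<Theta> \<otimes> 1\<close> acts slice by slice.
\<close>

section \<open>Slices of operators and maps\<close>

text \<open>This is the operator (1 \<otimes> \<langle>m|) X (1 \<otimes> |n\<rangle>) on the first
  factor, of dimension \<open>d\<close>; the second factor has dimension \<open>c\<close>.\<close>

definition mat_slice :: "nat \<Rightarrow> nat \<Rightarrow> complex mat \<Rightarrow> nat \<Rightarrow> nat \<Rightarrow> complex mat" where
  "mat_slice d c X m n = mat d d (\<lambda>(u, v). X $$ (u * c + m, v * c + n))"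

text \<open>Fixing all four indices of \<open>C\<close> turns a bipartite map into elements of
  \<open>lin_maps A\<close>, on which \<open>\<Theta>\<close> can act directly.\<close>

definition map_slice :: "party \<Rightarrow> party \<Rightarrow> cmap \<Rightarrow> nat \<Rightarrow> nat \<Rightarrow> nat \<Rightarrow> nat \<Rightarrow> cmap" where
  "map_slice A C \<Gamma> m n p q =
    (\<lambda>X\<in>ops (din A). mat_slice (dout A) (dout C) (\<Gamma> (X \<otimes>\<^sub>M unit_op (din C) m n)) p q)"

lemma mat_slice_carrier [simp]: "mat_slice d c X m n \<in> ops d"
  by (simp add: mat_slice_def)

section \<open>Sums and traces over a tensor product in coordinates\<close>

lemma sum_tensor_index:
  "(\<Sum>r<a * c. f r) = (\<Sum>i<a. \<Sum>k<c. f (i * c + k :: nat) :: 'a :: comm_monoid_add)"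
proof -
  have "(\<Sum>r<a * c. f r) = (\<Sum>(i, k)\<in>{..<a} \<times> {..<c}. f (i * c + k))"
    by (rule sum.reindex_bij_witness[where i = "\<lambda>(i, k). i * c + k" and j = "\<lambda>r. (r div c, r mod c)"])
      (auto simp: div_less_dim mod_less_dim index_less)
  then show ?thesis by (simp add: sum.cartesian_product)
qed

lemma sum_swap_pairs:
  "(\<Sum>a\<in>S. \<Sum>b\<in>T. \<Sum>c\<in>U. \<Sum>d\<in>V. h a b c d) =
    (\<Sum>c\<in>U. \<Sum>d\<in>V. \<Sum>a\<in>S. \<Sum>b\<in>T. (h a b c d :: 'a :: comm_monoid_add))"
proof -
  have "(\<Sum>a\<in>S. \<Sum>b\<in>T. \<Sum>c\<in>U. \<Sum>d\<in>V. h a b c d) =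
      (\<Sum>c\<in>U. \<Sum>a\<in>S. \<Sum>b\<in>T. \<Sum>d\<in>V. h a b c d)"
    by (rule sum_rotate)
  also have "\<dots> = (\<Sum>c\<in>U. \<Sum>d\<in>V. \<Sum>a\<in>S. \<Sum>b\<in>T. h a b c d)"
    by (rule sum.cong[OF refl], rule sum_rotate)
  finally show ?thesis .
qed

lemma trace_eq_sum_trace_mat_slice:
  assumes "X \<in> ops (a * c)"
  shows "trace X = (\<Sum>p<c. trace (mat_slice a c X p p))"
proof -
  have "trace X = (\<Sum>i<a. \<Sum>p<c. X $$ (i * c + p, i * c + p))"
    using assms by (simp add: trace_def sum_tensor_index)
  also have "\<dots> = (\<Sum>p<c. \<Sum>i<a. X $$ (i * c + p, i * c + p))"
    by (rule sum.swap)
  finally show ?thesis by (simp add: trace_def mat_slice_def)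
qed

lemma trace_mat_tensor:
  assumes "X \<in> ops a" "Y \<in> ops c"
  shows "trace (X \<otimes>\<^sub>M Y) = trace X * trace Y"
proof -
  have "trace (X \<otimes>\<^sub>M Y) = (\<Sum>i<a. \<Sum>k<c. X $$ (i, i) * Y $$ (k, k))"
    using assms carrier_matD[OF mat_tensor_carrier[OF assms]]
    by (auto simp: trace_def sum_tensor_index mat_tensor_index' intro!: sum.cong)
  then show ?thesis using assms by (simp add: trace_def sum_product)
qed

lemma trace_unit_op: "m < d \<Longrightarrow> trace (unit_op d m n) = (if m = n then 1 else 0)"
  by (auto simp: trace_def unit_op_def if_distrib cong: if_cong)

lemma mat_tensor_add_left:
  assumes "X \<in> ops a" "Y \<in> ops a" "Z \<in> ops c"
  shows "(X + Y) \<otimes>\<^sub>M Z = X \<otimes>\<^sub>M Z + Y \<otimes>\<^sub>M Z"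
  using assms by (intro eq_matI) (auto simp: mat_tensor_def distrib_right div_less_dim)

lemma mat_tensor_smult_left:
  assumes "X \<in> ops a" "Z \<in> ops c"
  shows "(e \<cdot>\<^sub>m X) \<otimes>\<^sub>M Z = e \<cdot>\<^sub>m (X \<otimes>\<^sub>M Z)"
  using assms by (intro eq_matI) (auto simp: mat_tensor_def div_less_dim)

lemma map_slice_in:
  assumes G: "\<Gamma> \<in> lin_maps (A \<otimes>\<^sub>P C)" and pq: "p < dout C" "q < dout C"
  shows "map_slice A C \<Gamma> m n p q \<in> lin_maps A"
proof -
  let ?T = "\<lambda>X. X \<otimes>\<^sub>M unit_op (din C) m n"
  have T: "?T X \<in> ops (din (A \<otimes>\<^sub>P C))" if "X \<in> ops (din A)" for X
    using that by (simp add: party_tensor_def)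
  have GT: "\<Gamma> (?T X) \<in> ops (dout A * dout C)" if "X \<in> ops (din A)" for X
    using lin_mapsD(1)[OF G T[OF that]] by (simp add: party_tensor_def)
  show ?thesis
    unfolding map_slice_def mat_slice_def
  proof (rule lin_maps_mat)
    fix X Y r s assume *: "X \<in> ops (din A)" "Y \<in> ops (din A)" "r < dout A" "s < dout A"
    show "\<Gamma> (?T (X + Y)) $$ (r * dout C + p, s * dout C + q) =
        \<Gamma> (?T X) $$ (r * dout C + p, s * dout C + q) + \<Gamma> (?T Y) $$ (r * dout C + p, s * dout C + q)"
      using GT[OF *(1)] GT[OF *(2)] * pq
      by (simp add: mat_tensor_add_left[OF *(1,2) unit_op_carrier] lin_mapsD(2)[OF G T T] index_less)
  next
    fix e X r s assume *: "X \<in> ops (din A)" "r < dout A" "s < dout A"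
    show "\<Gamma> (?T (e \<cdot>\<^sub>m X)) $$ (r * dout C + p, s * dout C + q) =
        e * \<Gamma> (?T X) $$ (r * dout C + p, s * dout C + q)"
      using GT[OF *(1)] * pq
      by (simp add: mat_tensor_smult_left[OF *(1) unit_op_carrier] lin_mapsD(3)[OF G T] index_less)
  qed
qed

lemma id_supermap_in: "id_supermap C \<in> supermaps C C"
  by (auto simp: id_supermap_def supermaps_def lmap_add_in lmap_smult_in)

lemma unit_map_unit_op_index:
  assumes "w < din C" "z < din C" "p' < dout C" "q' < dout C" "m < din C" "n < din C"
  shows "unit_map C m n p q (unit_op (din C) w z) $$ (p', q') =
    (if m = w \<and> n = z \<and> p = p' \<and> q = q' then 1 else 0)"
  using assms by (auto simp: unit_map_def unit_op_def)

text \<open>The identity on \<open>C\<close> forces the output indices of \<open>C\<close> to be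
  those of the entry, while its input indices are summed against the blocks of \<open>X\<close>.
  Trace preservation and uniformity of the extended map are both reduced to \<open>\<Theta>\<close>
  alone through this formula.\<close>

lemma supermap_tensor_id_slice:
  assumes \<Theta>: "\<Theta> \<in> supermaps A B" and G: "\<Gamma> \<in> lin_maps (A \<otimes>\<^sub>P C)" and X: "X \<in> ops (din B * din C)"
    and p: "p < dout C" "q < dout C"
    and r: "r < dout B" "s < dout B"
  shows "supermap_tensor A B C C \<Theta> (id_supermap C) \<Gamma> X $$ (r * dout C + p, s * dout C + q) =
    (\<Sum>m<din C. \<Sum>n<din C. \<Theta> (map_slice A C \<Gamma> m n p q) (mat_slice (din B) (din C) X m n) $$ (r, s))"
proof -
  define g where "g = (\<lambda>i j m n k p l q. \<Gamma> (unit_op (din A) i j \<otimes>\<^sub>M unit_op (din C) m n) $$ (k * dout C + p, l * dout C + q))"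
  have rs: "r * dout C + p < dout B * dout C" "s * dout C + q < dout B * dout C"
    using p r by (auto simp: index_less)
  have U: "unit_map A i j k l \<in> lin_maps A" "\<Theta> (unit_map A i j k l) \<in> lin_maps B"
    if "(i, j, k, l) \<in> map_idx A" for i j k l
    using that by (auto intro: supermapsD(1)[OF \<Theta>] simp: map_idx_def)
  have mt: "map_tensor B C (\<Theta> (unit_map A i j k l)) (id_supermap C (unit_map C m n p' q')) X $$ (r * dout C + p, s * dout C + q) =
     (if q' = q then if p' = p then \<Theta> (unit_map A i j k l) (mat_slice (din B) (din C) X m n) $$ (r, s) else 0 else 0)"
    if a: "(i, j, k, l) \<in> map_idx A" and c: "(m, n, p', q') \<in> map_idx C" for i j k l m n p' q'
  proof -
    have c': "m < din C" "n < din C" using c by (auto simp: map_idx_def)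
    let ?F = "\<lambda>u v. \<Theta> (unit_map A i j k l) (unit_op (din B) u v) $$ (r, s)"
    have "map_tensor B C (\<Theta> (unit_map A i j k l)) (id_supermap C (unit_map C m n p' q')) X $$ (r * dout C + p, s * dout C + q) =
      (\<Sum>u<din B. \<Sum>v<din B. \<Sum>w<din C. \<Sum>z<din C. X $$ (u * din C + w, v * din C + z) *
         (?F u v * unit_map C m n p' q' (unit_op (din C) w z) $$ (p, q)))"
      using c' p r by (simp add: id_supermap_def map_tensor_index[OF U(2)[OF a] _ X rs])
    \<comment> \<open>The unit map of \<open>C\<close> reacts only to the operator
      |m\<rangle>\<langle>n| and returns |p'\<rangle>\<langle>q'|. The tests on \<open>z\<close> and
      \<open>w\<close> are nested one variable at a time, so that each sum collapses.\<close>
    also have "\<dots> = (\<Sum>u<din B. \<Sum>v<din B. \<Sum>w<din C. \<Sum>z<din C.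
        if z = n then if w = m then if p' = p \<and> q' = q then X $$ (u * din C + m, v * din C + n) * ?F u v else 0 else 0 else 0)"
      using c' p by (intro sum.cong refl) (auto simp: unit_map_unit_op_index)
    also have "\<dots> = (if p' = p \<and> q' = q then (\<Sum>u<din B. \<Sum>v<din B. X $$ (u * din C + m, v * din C + n) * ?F u v) else 0)"
      using c' by (cases "p' = p"; cases "q' = q") simp_all
    also have "(\<Sum>u<din B. \<Sum>v<din B. X $$ (u * din C + m, v * din C + n) * ?F u v) =
        \<Theta> (unit_map A i j k l) (mat_slice (din B) (din C) X m n) $$ (r, s)"
      unfolding lin_map_expand[OF U(2)[OF a] mat_slice_carrier r] by (simp add: mat_slice_def)
    finally show ?thesis by auto
  qed
  have "supermap_tensor A B C C \<Theta> (id_supermap C) \<Gamma> X $$ (r * dout C + p, s * dout C + q) =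
    (\<Sum>(i, j, k, l)\<in>map_idx A. \<Sum>(m, n, p', q')\<in>map_idx C. g i j m n k p' l q' *
      (if q' = q then if p' = p then \<Theta> (unit_map A i j k l) (mat_slice (din B) (din C) X m n) $$ (r, s) else 0 else 0))"
    using G X rs by (simp add: supermap_tensor_def g_def) (auto simp: mt intro!: sum.cong)
  also have "\<dots> = (\<Sum>(i, j, k, l)\<in>map_idx A. \<Sum>m<din C. \<Sum>n<din C. g i j m n k p l q *
      \<Theta> (unit_map A i j k l) (mat_slice (din B) (din C) X m n) $$ (r, s))"
    using p by (simp add: sum_map_idx[of _ C] if_distrib[of "\<lambda>x. _ * x"] cong: if_cong)
  also have "\<dots> = (\<Sum>m<din C. \<Sum>n<din C. \<Sum>(i, j, k, l)\<in>map_idx A. g i j m n k p l q *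
      \<Theta> (unit_map A i j k l) (mat_slice (din B) (din C) X m n) $$ (r, s))"
    unfolding case_prod_unfold by (subst sum.swap, rule sum.cong[OF refl], rule sum.swap)
  \<comment> \<open>The numbers \<open>g\<close> are the coefficients of the slice in the basis of
    unit maps, so the sum over \<open>map_idx A\<close> reassembles \<open>\<Theta>\<close> of that
    slice.\<close>
  also have "\<dots> = (\<Sum>m<din C. \<Sum>n<din C. \<Theta> (map_slice A C \<Gamma> m n p q) (mat_slice (din B) (din C) X m n) $$ (r, s))"
    unfolding supermap_expand[OF \<Theta> map_slice_in[OF G p] mat_slice_carrier r]
    by (intro sum.cong refl) (auto simp: map_slice_def mat_slice_def g_def map_idx_def)
  finally show ?thesis .
qed

section \<open>Trace-annihilating maps and maps with uniform output\<close>

definition trace_annihilating :: "party \<Rightarrow> cmap \<Rightarrow> bool" where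
  "trace_annihilating A \<Phi> \<longleftrightarrow> \<Phi> \<in> lin_maps A \<and> (\<forall>X\<in>ops (din A). trace (\<Phi> X) = 0)"

text \<open>The functional \<lambda> in X \<mapsto> \<lambda>(X) u is recovered as the trace of the
  output, since u has trace one in positive dimension. In output dimension 0 the condition holds for
  every linear map.\<close>

definition uniform_output :: "party \<Rightarrow> cmap \<Rightarrow> bool" where
  "uniform_output A \<Phi> \<longleftrightarrow> \<Phi> \<in> lin_maps A \<and>
     (\<forall>X\<in>ops (din A). \<Phi> X = trace (\<Phi> X) \<cdot>\<^sub>m uniform_state (dout A))"

lemma trace_add: "X \<in> ops d \<Longrightarrow> Y \<in> ops d \<Longrightarrow> trace (X + Y) = trace X + trace Y"
  by (simp add: trace_def sum.distrib)

lemma trace_smult: "trace (c \<cdot>\<^sub>m X) = c * trace X" if "X \<in> ops d"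
  using that by (simp add: trace_def sum_distrib_left)

lemma trace_lmap_add:
  assumes "\<Phi> \<in> lin_maps A" "\<Psi> \<in> lin_maps A" "X \<in> ops (din A)"
  shows "trace (lmap_add A \<Phi> \<Psi> X) = trace (\<Phi> X) + trace (\<Psi> X)"
  using assms by (simp add: lmap_add_def trace_add[OF lin_mapsD(1) lin_mapsD(1)])

lemma trace_lmap_smult:
  assumes "\<Phi> \<in> lin_maps A" "X \<in> ops (din A)"
  shows "trace (lmap_smult A c \<Phi> X) = c * trace (\<Phi> X)"
  using assms by (simp add: lmap_smult_def trace_smult[OF lin_mapsD(1)])

text \<open>The witness is X \<mapsto> Tr[X] |0\<rangle>\<langle>0|, for which a basis vector with
  index 0 has to exist.\<close>

lemma ex_trace_preserving:
  assumes "0 < dout A"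
  shows "\<exists>\<Phi>. trace_preserving A \<Phi>"
proof
  let ?\<Phi> = "\<lambda>X\<in>ops (din A). mat (dout A) (dout A) (\<lambda>(r, s). if r = 0 \<and> s = 0 then trace X else 0)"
  have "?\<Phi> \<in> lin_maps A"
    by (rule lin_maps_mat) (auto simp: trace_add trace_smult)
  moreover have "trace (?\<Phi> X) = trace X" if "X \<in> ops (din A)" for X
    using that assms by (simp add: trace_def[of "mat _ _ _"])
  ultimately show "trace_preserving A ?\<Phi>"
    by (auto simp: trace_preserving_def)
qed

text \<open>Adding a trace-annihilating map to a trace-preserving one gives another trace-preserving
  map. The images of the two have equal traces, so the image of their difference has trace
  zero.\<close>

lemma supermap_trace_annihilating:
  assumes \<Theta>: "\<Theta> \<in> supermaps A B" and d: "dout A = dout B"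
    and tp: "\<And>\<Phi>. trace_preserving A \<Phi> \<Longrightarrow> trace_preserving B (\<Theta> \<Phi>)"
    and ta: "trace_annihilating A \<Psi>"
  shows "trace_annihilating B (\<Theta> \<Psi>)"
  unfolding trace_annihilating_def
proof (intro conjI ballI)
  have P: "\<Psi> \<in> lin_maps A" using ta by (simp add: trace_annihilating_def)
  then show TP: "\<Theta> \<Psi> \<in> lin_maps B" by (rule supermapsD(1)[OF \<Theta>])
  fix X assume X: "X \<in> ops (din B)"
  show "trace (\<Theta> \<Psi> X) = 0"
  \<comment> \<open>Output dimension 0 may leave no trace-preserving map to start from; there the
    equal output dimensions make \<open>\<Theta> \<Psi> X\<close> an empty matrix.\<close>
  proof (cases "dout A = 0")
    case True
    then show ?thesis using lin_mapsD(1)[OF TP X] d by (simp add: trace_def)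
  next
    case False
    then obtain \<Phi> where F: "trace_preserving A \<Phi>" using ex_trace_preserving by auto
    then have FL: "\<Phi> \<in> lin_maps A" by (simp add: trace_preserving_def)
    have "trace_preserving A (lmap_add A \<Phi> \<Psi>)"
      using F ta FL P by (auto simp: trace_preserving_def trace_annihilating_def lmap_add_in trace_lmap_add)
    then have "trace (\<Theta> (lmap_add A \<Phi> \<Psi>) X) = trace X"
      using tp X by (simp add: trace_preserving_def)
    moreover have "trace (\<Theta> (lmap_add A \<Phi> \<Psi>) X) = trace (\<Theta> \<Phi> X) + trace (\<Theta> \<Psi> X)"
      using X by (simp add: supermapsD(2)[OF \<Theta> FL P] trace_lmap_add[OF supermapsD(1)[OF \<Theta> FL] TP])
    moreover have "trace (\<Theta> \<Phi> X) = trace X"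
      using tp[OF F] X by (simp add: trace_preserving_def)
    ultimately show ?thesis by simp
  qed
qed

section \<open>Orthogonality of the two classes of maps\<close>

lemma map_inner_cnj:
  assumes "\<Phi> \<in> lin_maps A" "\<Psi> \<in> lin_maps A"
  shows "map_inner A \<Psi> \<Phi> = cnj (map_inner A \<Phi> \<Psi>)"
  by (simp add: map_inner_alt assms case_prod_unfold mult.commute)

lemma uniform_output_index:
  assumes "uniform_output A \<Phi>" "X \<in> ops (din A)" "r < dout A" "s < dout A"
  shows "\<Phi> X $$ (r, s) = (if r = s then trace (\<Phi> X) / of_nat (dout A) else 0)"
proof -
  have "\<Phi> X = trace (\<Phi> X) \<cdot>\<^sub>m uniform_state (dout A)"
    using assms by (simp add: uniform_output_def)
  then have "\<Phi> X $$ (r, s) = (trace (\<Phi> X) \<cdot>\<^sub>m uniform_state (dout A)) $$ (r, s)" by (rule arg_cong)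
  then show ?thesis using assms by (simp add: uniform_state_def)
qed

text \<open>Each \<open>\<Phi> X\<close> is a multiple of the identity, so pairing it with
  \<open>\<Psi> X\<close> yields a multiple of the trace of \<open>\<Psi> X\<close>, which
  vanishes.\<close>

lemma map_inner_uniform_output_trace_annihilating:
  assumes "uniform_output A \<Phi>" "trace_annihilating A \<Psi>"
  shows "map_inner A \<Phi> \<Psi> = 0"
proof -
  have P: "\<Phi> \<in> lin_maps A" "\<Psi> \<in> lin_maps A"
    using assms by (auto simp: uniform_output_def trace_annihilating_def)
  have 0: "(\<Sum>k<dout A. \<Sum>l<dout A. cnj (\<Phi> X $$ (k, l)) * \<Psi> X $$ (k, l)) = 0"
    if X: "X \<in> ops (din A)" for X
  proof -
    define t where "t = trace (\<Phi> X) / of_nat (dout A)"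
    have "\<Phi> X $$ (k, l) = (if k = l then t else 0)" if "k < dout A" "l < dout A" for k l
      using uniform_output_index[OF assms(1) X that] by (simp add: t_def)
    then have "(\<Sum>k<dout A. \<Sum>l<dout A. cnj (\<Phi> X $$ (k, l)) * \<Psi> X $$ (k, l)) =
        (\<Sum>k<dout A. \<Sum>l<dout A. if l = k then cnj t * \<Psi> X $$ (k, k) else 0)"
      by (intro sum.cong refl) auto
    also have "\<dots> = cnj t * trace (\<Psi> X)"
      using lin_mapsD(1)[OF P(2) X] by (simp add: trace_def sum_distrib_left)
    finally show ?thesis using assms(2) X by (simp add: trace_annihilating_def)
  qed
  show ?thesis by (simp add: map_inner_alt[OF P] sum_map_idx 0)
qed

text \<open>Two families of trace-annihilating maps suffice as tests. Those with output along
  |k\<rangle>\<langle>l|, k \<noteq> l, kill the off-diagonal entries; those with output along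
  |k\<rangle>\<langle>k| - |l\<rangle>\<langle>l| make the diagonal entries agree.\<close>

lemma uniform_outputI:
  assumes P: "\<Phi> \<in> lin_maps A"
    and orth: "\<And>\<Psi>. trace_annihilating A \<Psi> \<Longrightarrow> map_inner A \<Phi> \<Psi> = 0"
  shows "uniform_output A \<Phi>"
  unfolding uniform_output_def
proof (intro conjI ballI P)
  have tr: "trace (unit_map A i j k l X) = (if k = l then X $$ (i, j) else 0)"
    if "k < dout A" "X \<in> ops (din A)" for i j k l X
    using that by (simp add: unit_map_def trace_smult[OF unit_op_carrier] trace_unit_op)
  have inner: "map_inner A \<Phi> (unit_map A i j k l) = cnj (\<Phi> (unit_op (din A) i j) $$ (k, l))"
    if "i < din A" "j < din A" "k < dout A" "l < dout A" for i j k l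
    using that P by (subst map_inner_cnj) (auto simp: map_inner_unit_map map_idx_def)
  have off: "\<Phi> (unit_op (din A) i j) $$ (k, l) = 0"
    if "i < din A" "j < din A" "k < dout A" "l < dout A" "k \<noteq> l" for i j k l
  proof -
    have "trace_annihilating A (unit_map A i j k l)"
      using that by (simp add: trace_annihilating_def tr)
    from orth[OF this] show ?thesis using that by (simp add: inner)
  qed
  have diag: "\<Phi> (unit_op (din A) i j) $$ (k, k) = \<Phi> (unit_op (din A) i j) $$ (l, l)"
    if "i < din A" "j < din A" "k < dout A" "l < dout A" for i j k l
  proof -
    let ?\<Psi> = "lmap_add A (unit_map A i j k k) (lmap_smult A (- 1) (unit_map A i j l l))"
    have "trace_annihilating A ?\<Psi>"
      using that by (simp add: trace_annihilating_def tr lmap_add_in lmap_smult_in trace_lmap_add trace_lmap_smult)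
    from orth[OF this] show ?thesis
      using that P by (simp add: inner map_inner_add map_inner_smult lmap_smult_in)
  qed
  fix X assume X: "X \<in> ops (din A)"
  have off': "\<Phi> X $$ (k, l) = 0" if "k < dout A" "l < dout A" "k \<noteq> l" for k l
    using that unfolding lin_map_expand[OF P X that(1,2)] by (simp add: off)
  have diag': "\<Phi> X $$ (k, k) = \<Phi> X $$ (l, l)" if "k < dout A" "l < dout A" for k l
    unfolding lin_map_expand[OF P X that(1) that(1)] lin_map_expand[OF P X that(2) that(2)]
    using that by (intro sum.cong refl arg_cong2[where f = "(*)"] diag) auto
  have c: "\<Phi> X \<in> ops (dout A)" using P X by (rule lin_mapsD(1))
  \<comment> \<open>All diagonal entries agree, so each is the trace divided by
    \<open>dout A\<close>. Stating this for every \<open>k < dout A\<close> leaves nothing to check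
    in output dimension 0.\<close>
  have "trace (\<Phi> X) = of_nat (dout A) * \<Phi> X $$ (k, k)" if "k < dout A" for k
  proof -
    have "trace (\<Phi> X) = (\<Sum>i<dout A. \<Phi> X $$ (k, k))"
      unfolding trace_def using c that by (intro sum.cong diag') auto
    then show ?thesis by simp
  qed
  then show "\<Phi> X = trace (\<Phi> X) \<cdot>\<^sub>m uniform_state (dout A)"
    using c off' by (intro eq_matI) (auto simp: uniform_state_def)
qed

section \<open>Transfer of uniform output through the dual supermap\<close>

lemma dual_supermap:
  assumes "\<Theta> \<in> supermaps A B"
  shows "dual_supermap A B \<Theta> \<in> supermaps B A"
    and "\<Phi> \<in> lin_maps A \<Longrightarrow> \<Psi> \<in> lin_maps B \<Longrightarrow>
      map_inner A \<Phi> (dual_supermap A B \<Theta> \<Psi>) = map_inner B (\<Theta> \<Phi>) \<Psi>"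
  using theI'[OF ex1_dual_supermap[OF assms], folded dual_supermap_def] by auto

text \<open>For trace-annihilating \<open>\<Psi>\<close>, the adjoint relation turns the inner
  product of \<open>\<Theta> \<Phi>\<close> with \<open>\<Psi>\<close> into that of
  \<open>\<Phi>\<close> with the image of \<open>\<Psi>\<close> under the dual. The dual is a
  superchannel, so this image is again trace annihilating and hence orthogonal to
  \<open>\<Phi>\<close>.\<close>

lemma doubly_stochastic_uniform_output:
  assumes ds: "doubly_stochastic A B \<Theta>" and d: "dout A = dout B" and u: "uniform_output A \<Phi>"
  shows "uniform_output B (\<Theta> \<Phi>)"
proof (rule uniform_outputI)
  have \<Theta>: "\<Theta> \<in> supermaps A B"
    and tp: "\<And>\<Phi>. trace_preserving B \<Phi> \<Longrightarrow> trace_preserving A (dual_supermap A B \<Theta> \<Phi>)"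
    using ds by (auto simp: doubly_stochastic_def superchannel_def)
  have P: "\<Phi> \<in> lin_maps A" using u by (simp add: uniform_output_def)
  then show "\<Theta> \<Phi> \<in> lin_maps B" by (rule supermapsD(1)[OF \<Theta>])
  fix \<Psi> assume "trace_annihilating B \<Psi>"
  then show "map_inner B (\<Theta> \<Phi>) \<Psi> = 0"
    using map_inner_uniform_output_trace_annihilating[OF u
        supermap_trace_annihilating[OF dual_supermap(1)[OF \<Theta>] d[symmetric] tp]]
    by (auto simp: dual_supermap(2)[OF \<Theta> P] trace_annihilating_def)
qed

section \<open>Trace preservation of the extended supermap\<close>

text \<open>The definition of \<open>superchannel\<close> speaks of trace preservation for
  \<open>\<Theta>\<close> itself, so the extension needs an argument. Feeding |m\<rangle>\<langle>n|
  into \<open>C\<close> and tracing out its output leaves a map that is trace preserving for m = n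
  and trace annihilating otherwise, and \<open>\<Theta>\<close> respects both classes.\<close>

lemma supermap_tensor_id_trace_preserving:
  assumes \<Theta>: "\<Theta> \<in> supermaps A B" and d: "dout A = dout B"
    and tp: "\<And>\<Phi>. trace_preserving A \<Phi> \<Longrightarrow> trace_preserving B (\<Theta> \<Phi>)"
    and G: "trace_preserving (A \<otimes>\<^sub>P C) \<Gamma>"
  shows "trace_preserving (B \<otimes>\<^sub>P C) (supermap_tensor A B C C \<Theta> (id_supermap C) \<Gamma>)"
  unfolding trace_preserving_def
proof (intro conjI ballI)
  have GL: "\<Gamma> \<in> lin_maps (A \<otimes>\<^sub>P C)" using G by (simp add: trace_preserving_def)
  from supermapsD(1)[OF supermap_tensor_in[OF \<Theta> id_supermap_in] GL]
  show Z: "supermap_tensor A B C C \<Theta> (id_supermap C) \<Gamma> \<in> lin_maps (B \<otimes>\<^sub>P C)" .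
  fix X assume "X \<in> ops (din (B \<otimes>\<^sub>P C))"
  then have X: "X \<in> ops (din B * din C)" and ZX:
    "supermap_tensor A B C C \<Theta> (id_supermap C) \<Gamma> X \<in> ops (dout B * dout C)"
    using lin_mapsD(1)[OF Z] by (auto simp: party_tensor_def)
  \<comment> \<open>This is the map X \<mapsto> Tr over the output of \<open>C\<close> of \<Gamma>(X
    \<otimes> |m\<rangle>\<langle>n|), written as a sum of slices so that linearity of
    \<open>\<Theta>\<close> applies.\<close>
  let ?S = "\<lambda>m n. lincomb A (\<lambda>p. 1) (\<lambda>p. map_slice A C \<Gamma> m n p p) {..<dout C}"
  have SL: "?S m n \<in> lin_maps A" for m n by (intro lincomb_in map_slice_in GL) auto
  have trS: "trace (?S m n Y) = trace Y * trace (unit_op (din C) m n)" if Y: "Y \<in> ops (din A)" for m n Y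
  proof -
    let ?T = "Y \<otimes>\<^sub>M unit_op (din C) m n"
    have T: "?T \<in> ops (din (A \<otimes>\<^sub>P C))" using Y by (simp add: party_tensor_def)
    have "trace (?S m n Y) = (\<Sum>i<dout A. \<Sum>p<dout C. \<Gamma> ?T $$ (i * dout C + p, i * dout C + p))"
      using Y by (simp add: trace_def lincomb_def map_slice_def mat_slice_def)
    also have "\<dots> = trace (\<Gamma> ?T)"
      using lin_mapsD(1)[OF GL T] by (simp add: trace_def sum_tensor_index party_tensor_def)
    also have "\<dots> = trace ?T" using G T by (simp add: trace_preserving_def)
    also have "\<dots> = trace Y * trace (unit_op (din C) m n)"
      using Y unit_op_carrier by (rule trace_mat_tensor)
    finally show ?thesis .
  qed
  have tr\<Theta>: "trace (\<Theta> (?S m n) Y) = (if n = m then trace Y else 0)"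
    if m: "m < din C" and Y: "Y \<in> ops (din B)" for m n Y
  proof (cases "n = m")
    case True
    have "trace_preserving A (?S m n)"
      using SL trS m True by (simp add: trace_preserving_def trace_unit_op)
    from tp[OF this] show ?thesis using True Y by (simp add: trace_preserving_def)
  next
    case False
    have "trace_annihilating A (?S m n)"
      using SL trS m False by (simp add: trace_annihilating_def trace_unit_op)
    from supermap_trace_annihilating[OF \<Theta> d tp this]
    show ?thesis using False Y by (simp add: trace_annihilating_def)
  qed
  have \<Theta>S: "trace (\<Theta> (?S m n) Y) = (\<Sum>i<dout B. \<Sum>p<dout C. \<Theta> (map_slice A C \<Gamma> m n p p) Y $$ (i, i))"
    if "Y \<in> ops (din B)" for m n Y
  proof -
    have "\<Theta> (?S m n) = lincomb B (\<lambda>p. 1) (\<lambda>p. \<Theta> (map_slice A C \<Gamma> m n p p)) {..<dout C}"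
      by (intro supermap_lincomb[OF \<Theta>] map_slice_in GL) auto
    then show ?thesis using that by (simp add: lincomb_def trace_def)
  qed
  let ?X = "mat_slice (din B) (din C) X"
  have "trace (supermap_tensor A B C C \<Theta> (id_supermap C) \<Gamma> X) =
      (\<Sum>i<dout B. \<Sum>p<dout C. \<Sum>m<din C. \<Sum>n<din C. \<Theta> (map_slice A C \<Gamma> m n p p) (?X m n) $$ (i, i))"
    using ZX by (auto simp: trace_def sum_tensor_index supermap_tensor_id_slice[OF \<Theta> GL X] intro!: sum.cong)
  also have "\<dots> = (\<Sum>m<din C. \<Sum>n<din C. \<Sum>i<dout B. \<Sum>p<dout C. \<Theta> (map_slice A C \<Gamma> m n p p) (?X m n) $$ (i, i))"
    by (rule sum_swap_pairs)
  also have "\<dots> = (\<Sum>m<din C. \<Sum>n<din C. trace (\<Theta> (?S m n) (?X m n)))"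
    by (simp add: \<Theta>S)
  \<comment> \<open>Only the diagonal blocks of \<open>X\<close> survive, and their traces add up to
    that of \<open>X\<close>.\<close>
  also have "\<dots> = (\<Sum>m<din C. trace (?X m m))"
    by (simp add: tr\<Theta>)
  also have "\<dots> = trace X" using X by (simp add: trace_eq_sum_trace_mat_slice)
  finally show "trace (supermap_tensor A B C C \<Theta> (id_supermap C) \<Gamma> X) = trace X" .
qed

section \<open>Complete positivity and exchange of the tensor factors\<close>

text \<open>The definition of superchannels extends by \<open>1 \<otimes> \<Theta>\<close>, uniformity preservation by \<open>\<Theta> \<otimes> 1\<close>.\<close>

definition swap_index :: "nat \<Rightarrow> nat \<Rightarrow> nat \<Rightarrow> nat" where
  "swap_index a c r = (r mod a) * c + r div a"

text \<open>The function \<open>swap_index a c\<close> sends the position \<open>k * a + i\<close>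
  of |k\<rangle> \<otimes> |i\<rangle> to the position \<open>i * c + k\<close> of |i\<rangle>
  \<otimes> |k\<rangle>. So for \<open>X\<close> on factors of dimensions \<open>a\<close> and
  \<open>c\<close>, this is its conjugate by the flip unitary, acting on factors of dimensions
  \<open>c\<close> and \<open>a\<close>.\<close>

definition mat_swap :: "nat \<Rightarrow> nat \<Rightarrow> complex mat \<Rightarrow> complex mat" where
  "mat_swap a c X = mat (c * a) (c * a) (\<lambda>(r, s). X $$ (swap_index a c r, swap_index a c s))"

text \<open>The input, with \<open>C\<close> first, is flipped before \<open>\<Gamma>\<close> acts,
  and the output is flipped back; hence the opposite order of the dimensions in the two
  flips.\<close>

definition map_swap :: "party \<Rightarrow> party \<Rightarrow> cmap \<Rightarrow> cmap" where
  "map_swap A C \<Gamma> = (\<lambda>X\<in>ops (din C * din A).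
     mat_swap (dout A) (dout C) (\<Gamma> (mat_swap (din C) (din A) X)))"

lemma index_div: "k < c \<Longrightarrow> (i * c + k) div c = (i :: nat)"
  by simp

lemma swap_index_less: "r < c * a \<Longrightarrow> swap_index a c r < a * c"
  unfolding swap_index_def by (intro index_less mod_less_dim div_less_dim)

lemma swap_index_index [simp]: "i < a \<Longrightarrow> swap_index a c (k * a + i) = i * c + k"
  by (simp add: swap_index_def)

lemma swap_index_swap [simp]: "r < c * a \<Longrightarrow> swap_index c a (swap_index a c r) = r"
  using div_less_dim[of r c a] by (simp add: swap_index_def)

lemma swap_index_div [simp]: "r < c * a \<Longrightarrow> swap_index a c r div c = r mod a"
  and swap_index_mod [simp]: "r < c * a \<Longrightarrow> swap_index a c r mod c = r div a"
  using div_less_dim[of r c a] by (auto simp: swap_index_def)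

lemma mat_swap_carrier [simp]: "mat_swap a c X \<in> ops (c * a)"
  by (simp add: mat_swap_def)

lemma mat_swap_mat_tensor:
  assumes "X \<in> ops a" "Y \<in> ops c"
  shows "mat_swap a c (X \<otimes>\<^sub>M Y) = Y \<otimes>\<^sub>M X"
  using assms
  by (intro eq_matI)
    (auto simp: mat_swap_def mat_tensor_index[of X a Y c] mat_tensor_index[of Y c X a] swap_index_less
      carrier_matD[OF mat_tensor_carrier[OF assms(2,1)]])

lemma map_swap_in:
  assumes G: "\<Gamma> \<in> lin_maps (A \<otimes>\<^sub>P C)"
  shows "map_swap A C \<Gamma> \<in> lin_maps (C \<otimes>\<^sub>P A)"
proof -
  let ?S = "mat_swap (din C) (din A)"
  have S: "?S X \<in> ops (din (A \<otimes>\<^sub>P C))" for X by (simp add: party_tensor_def)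
  have GS: "\<Gamma> (?S X) \<in> ops (dout A * dout C)" for X
    using lin_mapsD(1)[OF G S] by (simp add: party_tensor_def)
  have "(\<lambda>X\<in>ops (din (C \<otimes>\<^sub>P A)). mat (dout (C \<otimes>\<^sub>P A)) (dout (C \<otimes>\<^sub>P A)) (\<lambda>(r, s).
      \<Gamma> (?S X) $$ (swap_index (dout A) (dout C) r, swap_index (dout A) (dout C) s))) \<in> lin_maps (C \<otimes>\<^sub>P A)"
  proof (rule lin_maps_mat)
    fix X Y r s assume *: "X \<in> ops (din (C \<otimes>\<^sub>P A))" "Y \<in> ops (din (C \<otimes>\<^sub>P A))"
      "r < dout (C \<otimes>\<^sub>P A)" "s < dout (C \<otimes>\<^sub>P A)"
    have "?S (X + Y) = ?S X + ?S Y"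
      using * by (intro eq_matI) (auto simp: mat_swap_def party_tensor_def swap_index_less)
    then show "\<Gamma> (?S (X + Y)) $$ (swap_index (dout A) (dout C) r, swap_index (dout A) (dout C) s) =
        \<Gamma> (?S X) $$ (swap_index (dout A) (dout C) r, swap_index (dout A) (dout C) s) +
        \<Gamma> (?S Y) $$ (swap_index (dout A) (dout C) r, swap_index (dout A) (dout C) s)"
      using * carrier_matD[OF GS] by (simp add: lin_mapsD(2)[OF G S S] party_tensor_def swap_index_less)
  next
    fix e X r s assume *: "X \<in> ops (din (C \<otimes>\<^sub>P A))" "r < dout (C \<otimes>\<^sub>P A)" "s < dout (C \<otimes>\<^sub>P A)"
    have "?S (e \<cdot>\<^sub>m X) = e \<cdot>\<^sub>m ?S X"
      using * by (intro eq_matI) (auto simp: mat_swap_def party_tensor_def swap_index_less)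
    then show "\<Gamma> (?S (e \<cdot>\<^sub>m X)) $$ (swap_index (dout A) (dout C) r, swap_index (dout A) (dout C) s) =
        e * \<Gamma> (?S X) $$ (swap_index (dout A) (dout C) r, swap_index (dout A) (dout C) s)"
      using * carrier_matD[OF GS] by (simp add: lin_mapsD(3)[OF G S] party_tensor_def swap_index_less)
  qed
  then show ?thesis by (simp add: map_swap_def mat_swap_def[of "dout A"] party_tensor_def)
qed

lemma map_tensor_swap:
  assumes f: "f \<in> lin_maps A" and g: "g \<in> lin_maps C" and X: "X \<in> ops (din A * din C)"
    and r: "r < dout A * dout C" and s: "s < dout A * dout C"
  shows "map_tensor A C f g X $$ (r, s) = map_tensor C A g f (mat_swap (din A) (din C) X) $$
    (swap_index (dout C) (dout A) r, swap_index (dout C) (dout A) s)"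
proof -
  let ?F = "\<lambda>i j. f (unit_op (din A) i j) $$ (r div dout C, s div dout C)"
  let ?G = "\<lambda>k l. g (unit_op (din C) k l) $$ (r mod dout C, s mod dout C)"
  have "map_tensor C A g f (mat_swap (din A) (din C) X) $$
      (swap_index (dout C) (dout A) r, swap_index (dout C) (dout A) s) =
      (\<Sum>k<din C. \<Sum>l<din C. \<Sum>i<din A. \<Sum>j<din A. X $$ (i * din C + k, j * din C + l) * (?G k l * ?F i j))"
    using r s by (subst map_tensor_index[OF g f mat_swap_carrier])
      (auto simp: swap_index_less mat_swap_def index_less intro!: sum.cong)
  also have "\<dots> = (\<Sum>i<din A. \<Sum>j<din A. \<Sum>k<din C. \<Sum>l<din C. X $$ (i * din C + k, j * din C + l) * (?G k l * ?F i j))"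
    by (rule sum_swap_pairs)
  finally show ?thesis by (simp add: map_tensor_index[OF f g X r s] mult.commute)
qed

text \<open>The two orders of extension differ by flips before and after. This holds term by term in
  the defining double sum: fact \<open>g\<close> matches the coefficients and fact \<open>t\<close>
  the tensor products of basis images.\<close>

lemma supermap_tensor_swap:
  assumes \<Theta>: "\<Theta> \<in> supermaps A B" and \<Xi>: "\<Xi> \<in> supermaps C D" and G: "\<Gamma> \<in> lin_maps (A \<otimes>\<^sub>P C)"
  shows "supermap_tensor A B C D \<Theta> \<Xi> \<Gamma> = map_swap D B (supermap_tensor C D A B \<Xi> \<Theta> (map_swap A C \<Gamma>))"
proof (rule lin_maps_eqI)
  let ?L = "supermap_tensor A B C D \<Theta> \<Xi> \<Gamma>"
  let ?R = "supermap_tensor C D A B \<Xi> \<Theta> (map_swap A C \<Gamma>)"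
  show "?L \<in> lin_maps (B \<otimes>\<^sub>P D)" by (intro supermapsD(1)[OF supermap_tensor_in[OF \<Theta> \<Xi>]] G)
  show "map_swap D B ?R \<in> lin_maps (B \<otimes>\<^sub>P D)"
    by (intro map_swap_in supermapsD(1)[OF supermap_tensor_in[OF \<Xi> \<Theta>]] G)
  fix X r s assume "X \<in> ops (din (B \<otimes>\<^sub>P D))" "r < dout (B \<otimes>\<^sub>P D)" "s < dout (B \<otimes>\<^sub>P D)"
  then have X: "X \<in> ops (din B * din D)" and r: "r < dout B * dout D" and s: "s < dout B * dout D"
    by (auto simp: party_tensor_def)
  have g: "map_swap A C \<Gamma> (unit_op (din C) m n \<otimes>\<^sub>M unit_op (din A) i j) $$ (p * dout A + k, q * dout A + l) =
      \<Gamma> (unit_op (din A) i j \<otimes>\<^sub>M unit_op (din C) m n) $$ (k * dout C + p, l * dout C + q)"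
    if "(i, j, k, l) \<in> map_idx A" "(m, n, p, q) \<in> map_idx C" for i j k l m n p q
    using that
    by (auto simp: map_swap_def mat_swap_mat_tensor mat_swap_def[of "dout A"] map_idx_def index_less)
  have t: "map_tensor D B (\<Xi> (unit_map C m n p q)) (\<Theta> (unit_map A i j k l)) (mat_swap (din B) (din D) X) $$
       (swap_index (dout D) (dout B) r, swap_index (dout D) (dout B) s) =
      map_tensor B D (\<Theta> (unit_map A i j k l)) (\<Xi> (unit_map C m n p q)) X $$ (r, s)"
    if "(i, j, k, l) \<in> map_idx A" "(m, n, p, q) \<in> map_idx C" for i j k l m n p q
    using that by (intro map_tensor_swap[symmetric] X r s supermapsD(1)[OF \<Theta>] supermapsD(1)[OF \<Xi>])
      (auto simp: map_idx_def)
  have "map_swap D B ?R X $$ (r, s) = ?R (mat_swap (din B) (din D) X) $$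
      (swap_index (dout D) (dout B) r, swap_index (dout D) (dout B) s)"
    using X r s by (simp add: map_swap_def mat_swap_def[of "dout D"])
  also have "\<dots> = (\<Sum>(m, n, p, q)\<in>map_idx C. \<Sum>(i, j, k, l)\<in>map_idx A.
         \<Gamma> (unit_op (din A) i j \<otimes>\<^sub>M unit_op (din C) m n) $$ (k * dout C + p, l * dout C + q) *
         map_tensor B D (\<Theta> (unit_map A i j k l)) (\<Xi> (unit_map C m n p q)) X $$ (r, s))"
    using r s by (simp add: supermap_tensor_def map_swap_in[OF G] swap_index_less)
      (auto simp: g t intro!: sum.cong)
  also have "\<dots> = ?L X $$ (r, s)"
    using X r s G by (simp add: supermap_tensor_def case_prod_unfold) (rule sum.swap)
  finally show "?L X $$ (r, s) = map_swap D B ?R X $$ (r, s)" by simp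
qed

text \<open>The reindexed matrix is V^* X V, where V sends the basis vector \<open>r\<close> to the
  basis vector \<open>f r\<close>, and such a congruence preserves positivity.\<close>

lemma psd_reindex:
  assumes X: "psd d X" and f: "\<And>r. r < e \<Longrightarrow> f r < d"
  shows "psd e (mat e e (\<lambda>(r, s). X $$ (f r, f s)))"
  unfolding psd_def
proof (intro conjI ballI)
  fix v :: "complex vec" assume v: "v \<in> carrier_vec e"
  let ?Y = "mat e e (\<lambda>(r, s). X $$ (f r, f s))"
  \<comment> \<open>This is V v: coordinate \<open>j\<close> collects all entries of
    \<open>v\<close> whose index is sent to \<open>j\<close>. Fact \<open>push\<close> then moves
    sums against \<open>w\<close> back to sums against \<open>v\<close>.\<close>
  define w where "w = vec d (\<lambda>j. \<Sum>r<e. if f r = j then v $ r else 0)"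
  have Xc: "X \<in> ops d" using X by (simp add: psd_def)
  have w: "w \<in> carrier_vec d" by (simp add: w_def)
  have push: "(\<Sum>j<d. F j * w $ j) = (\<Sum>r<e. F (f r) * v $ r)" for F
  proof -
    have "(\<Sum>j<d. F j * w $ j) = (\<Sum>j<d. \<Sum>r<e. if f r = j then F j * v $ r else 0)"
      by (auto simp: w_def sum_distrib_left intro!: sum.cong)
    also have "\<dots> = (\<Sum>r<e. \<Sum>j<d. if f r = j then F j * v $ r else 0)"
      by (rule sum.swap)
    also have "\<dots> = (\<Sum>r<e. F (f r) * v $ r)"
      using f by (intro sum.cong) auto
    finally show ?thesis .
  qed
  have push': "(\<Sum>j<d. F j * cnj (w $ j)) = (\<Sum>r<e. F (f r) * cnj (v $ r))" for F
    using arg_cong[OF push[of "\<lambda>j. cnj (F j)"], of cnj] by simp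
  have "(?Y *\<^sub>v v) \<bullet>c v = (\<Sum>r<e. (\<Sum>s<e. X $$ (f r, f s) * v $ s) * cnj (v $ r))"
    using v by (auto simp: scalar_prod_def atLeast0LessThan intro!: sum.cong)
  also have "\<dots> = (\<Sum>i<d. (\<Sum>j<d. X $$ (i, j) * w $ j) * cnj (w $ i))"
    by (simp add: push push')
  also have "\<dots> = (X *\<^sub>v w) \<bullet>c w"
    using Xc w by (auto simp: scalar_prod_def atLeast0LessThan intro!: sum.cong)
  finally show "0 \<le> (?Y *\<^sub>v v) \<bullet>c v"
    using X w by (simp add: psd_def)
qed simp

text \<open>The identity factor keeps the ancilla indices, so \<open>\<Phi>\<close> acts on every
  block of the n by n block matrix \<open>X\<close> separately.\<close>

lemma map_tensor_id_index:
  assumes P: "\<Phi> \<in> lin_maps A" and X: "X \<in> ops (n * din A)" and xy: "x < n" "y < n"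
    and rs: "r < dout A" "s < dout A"
  shows "map_tensor (Party n n) A (\<lambda>Y\<in>ops n. Y) \<Phi> X $$ (x * dout A + r, y * dout A + s) =
    \<Phi> (mat (din A) (din A) (\<lambda>(k, l). X $$ (x * din A + k, y * din A + l))) $$ (r, s)"
proof -
  have id: "(\<lambda>Y\<in>ops n. Y) \<in> lin_maps (Party n n)" by (auto simp: lin_maps_def)
  have "map_tensor (Party n n) A (\<lambda>Y\<in>ops n. Y) \<Phi> X $$ (x * dout A + r, y * dout A + s) =
     (\<Sum>i<n. \<Sum>j<n. \<Sum>k<din A. \<Sum>l<din A. X $$ (i * din A + k, j * din A + l) *
       (unit_op n i j $$ (x, y) * \<Phi> (unit_op (din A) k l) $$ (r, s)))"
    using X xy rs by (subst map_tensor_index[OF id P]) (auto simp: index_less)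
  also have "\<dots> = (\<Sum>i<n. \<Sum>j<n. if j = y then if i = x then \<Sum>k<din A. \<Sum>l<din A.
      X $$ (x * din A + k, y * din A + l) * \<Phi> (unit_op (din A) k l) $$ (r, s) else 0 else 0)"
    using xy by (intro sum.cong refl) (auto simp: unit_op_def)
  also have "\<dots> = (\<Sum>k<din A. \<Sum>l<din A.
      X $$ (x * din A + k, y * din A + l) * \<Phi> (unit_op (din A) k l) $$ (r, s))"
    using xy by simp
  also have "\<dots> = \<Phi> (mat (din A) (din A) (\<lambda>(k, l). X $$ (x * din A + k, y * din A + l))) $$ (r, s)"
    by (subst lin_map_expand[OF P _ rs]) auto
  finally show ?thesis .
qed

text \<open>Flips only permute the basis, so \<open>psd_reindex\<close> carries positivity through
  them. With an ancilla attached, the swapped map is flip, then \<open>\<Gamma>\<close>, then flip,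
  each acting beside the ancilla.\<close>

lemma completely_positive_map_swap:
  assumes cp: "completely_positive (A \<otimes>\<^sub>P C) \<Gamma>"
  shows "completely_positive (C \<otimes>\<^sub>P A) (map_swap A C \<Gamma>)"
  unfolding completely_positive_def
proof (intro conjI allI impI)
  have G: "\<Gamma> \<in> lin_maps (A \<otimes>\<^sub>P C)" using cp by (simp add: completely_positive_def)
  then show SG: "map_swap A C \<Gamma> \<in> lin_maps (C \<otimes>\<^sub>P A)" by (rule map_swap_in)
  fix n X assume "psd (n * din (C \<otimes>\<^sub>P A)) X"
  then have X: "psd (n * (din C * din A)) X" by (simp add: party_tensor_def)
  then have Xc: "X \<in> ops (n * (din C * din A))" by (simp add: psd_def)
  \<comment> \<open>The quotient by \<open>c * a\<close> is the ancilla index and stays; the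
    remainder is a position inside the block and is flipped.\<close>
  define lift where "lift a c r = r div (c * a) * (a * c) + swap_index a c (r mod (c * a))" for a c r :: nat
  have lift_less: "lift a c r < n * (a * c)" if "r < n * (c * a)" for a c r
    using that unfolding lift_def by (intro index_less swap_index_less mod_less_dim div_less_dim)
  let ?id = "\<lambda>Y\<in>ops n. Y"
  let ?h = "lift (dout A) (dout C)"
  define X' where "X' = mat (n * (din A * din C)) (n * (din A * din C))
    (\<lambda>(r, s). X $$ (lift (din C) (din A) r, lift (din C) (din A) s))"
  define Z where "Z = map_tensor (Party n n) (A \<otimes>\<^sub>P C) ?id \<Gamma> X'"
  have "psd (n * (din A * din C)) X'"
    unfolding X'_def using X lift_less by (rule psd_reindex)
  then have Zp: "psd (n * (dout A * dout C)) Z"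
    using cp by (simp add: Z_def completely_positive_def party_tensor_def)
  have X': "X' \<in> ops (n * din (A \<otimes>\<^sub>P C))" by (simp add: X'_def party_tensor_def)
  let ?W = "map_tensor (Party n n) (C \<otimes>\<^sub>P A) ?id (map_swap A C \<Gamma>) X"
  let ?N = "n * (dout C * dout A)"
  \<comment> \<open>The flips commute with attaching the ancilla; the two sides are compared inside
    each ancilla block.\<close>
  have "?W = mat ?N ?N (\<lambda>(r, s). Z $$ (?h r, ?h s))"
  proof (rule eq_matI)
    show "dim_row ?W = dim_row (mat ?N ?N (\<lambda>(r, s). Z $$ (?h r, ?h s)))"
      "dim_col ?W = dim_col (mat ?N ?N (\<lambda>(r, s). Z $$ (?h r, ?h s)))"
      using Xc by (auto simp: map_tensor_def party_tensor_def)
    fix r s assume "r < dim_row (mat ?N ?N (\<lambda>(r, s). Z $$ (?h r, ?h s)))"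
      "s < dim_col (mat ?N ?N (\<lambda>(r, s). Z $$ (?h r, ?h s)))"
    then have rs: "r < ?N" "s < ?N" by auto
    let ?x = "r div (dout C * dout A)" and ?y = "s div (dout C * dout A)"
      and ?u = "r mod (dout C * dout A)" and ?v = "s mod (dout C * dout A)"
    have xy: "?x < n" "?y < n" using rs by (auto intro: div_less_dim)
    have uv: "?u < dout C * dout A" "?v < dout C * dout A" using rs by (auto intro: mod_less_dim)
    let ?M = "mat (din C * din A) (din C * din A)
      (\<lambda>(k, l). X $$ (?x * (din C * din A) + k, ?y * (din C * din A) + l))"
    let ?M' = "mat (din A * din C) (din A * din C)
      (\<lambda>(k, l). X' $$ (?x * (din A * din C) + k, ?y * (din A * din C) + l))"
    \<comment> \<open>Since \<open>lift\<close> fixes the ancilla index, the blocks of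
      \<open>X'\<close> are the flipped blocks of \<open>X\<close>.\<close>
    have M: "mat_swap (din C) (din A) ?M = ?M'"
    proof (rule eq_matI)
      fix k l assume "k < dim_row ?M'" "l < dim_col ?M'"
      then have kl: "k < din A * din C" "l < din A * din C" by auto
      then have "mat_swap (din C) (din A) ?M $$ (k, l) = X $$
        (?x * (din C * din A) + swap_index (din C) (din A) k, ?y * (din C * din A) + swap_index (din C) (din A) l)"
        by (simp add: mat_swap_def swap_index_less)
      also have "\<dots> = ?M' $$ (k, l)"
        using kl xy index_less[OF xy(1) kl(1)] index_less[OF xy(2) kl(2)]
          index_div[OF kl(1), of ?x] index_div[OF kl(2), of ?y]
        by (simp add: X'_def lift_def)
      finally show "mat_swap (din C) (din A) ?M $$ (k, l) = ?M' $$ (k, l)" .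
    qed (auto simp: mat_swap_def)
    have "?W $$ (r, s) = ?W $$ (?x * dout (C \<otimes>\<^sub>P A) + ?u, ?y * dout (C \<otimes>\<^sub>P A) + ?v)"
      by (simp only: party_tensor_def party.sel div_mult_mod_eq)
    also have "\<dots> = map_swap A C \<Gamma> ?M $$ (?u, ?v)"
      using Xc xy uv by (subst map_tensor_id_index[OF SG]) (auto simp: party_tensor_def)
    also have "\<dots> = \<Gamma> ?M' $$ (swap_index (dout A) (dout C) ?u, swap_index (dout A) (dout C) ?v)"
      using uv by (simp add: map_swap_def M) (simp add: mat_swap_def)
    also have "\<dots> = Z $$ (?x * dout (A \<otimes>\<^sub>P C) + swap_index (dout A) (dout C) ?u,
        ?y * dout (A \<otimes>\<^sub>P C) + swap_index (dout A) (dout C) ?v)"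
      unfolding Z_def using uv swap_index_less[OF uv(1)] swap_index_less[OF uv(2)]
      by (subst map_tensor_id_index[OF G X' xy]) (auto simp: party_tensor_def)
    finally show "?W $$ (r, s) = mat ?N ?N (\<lambda>(r, s). Z $$ (?h r, ?h s)) $$ (r, s)"
      using rs by (simp add: lift_def party_tensor_def)
  qed
  moreover have "psd ?N (mat ?N ?N (\<lambda>(r, s). Z $$ (?h r, ?h s)))"
    using Zp lift_less by (rule psd_reindex)
  ultimately show "psd (n * dout (C \<otimes>\<^sub>P A)) ?W" by (simp add: party_tensor_def)
qed

text \<open>Complete positivity is known for the extension with \<open>C\<close> on the left;
  flipping the channel, extending and flipping back moves it to the right.\<close>

lemma superchannel_tensor_id_channel:
  assumes sc: "superchannel A B \<Theta>" and d: "dout A = dout B" and ch: "channel (A \<otimes>\<^sub>P C) \<Phi>"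
  shows "channel (B \<otimes>\<^sub>P C) (supermap_tensor A B C C \<Theta> (id_supermap C) \<Phi>)"
proof -
  have \<Theta>: "\<Theta> \<in> supermaps A B" using sc by (simp add: superchannel_def)
  have P: "\<Phi> \<in> lin_maps (A \<otimes>\<^sub>P C)" using ch by (simp add: channel_def trace_preserving_def)
  have "completely_positive (C \<otimes>\<^sub>P A) (map_swap A C \<Phi>)"
    using ch by (simp add: channel_def completely_positive_map_swap)
  then have "completely_positive (C \<otimes>\<^sub>P B) (supermap_tensor C C A B (id_supermap C) \<Theta> (map_swap A C \<Phi>))"
    using sc by (simp add: superchannel_def)
  from completely_positive_map_swap[OF this]
  have "completely_positive (B \<otimes>\<^sub>P C) (supermap_tensor A B C C \<Theta> (id_supermap C) \<Phi>)"
    by (simp add: supermap_tensor_swap[OF \<Theta> id_supermap_in P])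
  moreover have "trace_preserving (B \<otimes>\<^sub>P C) (supermap_tensor A B C C \<Theta> (id_supermap C) \<Phi>)"
    using sc ch by (intro supermap_tensor_id_trace_preserving[OF \<Theta> d]) (auto simp: superchannel_def channel_def)
  ultimately show ?thesis by (simp add: channel_def)
qed

section \<open>Complete uniformity preservation\<close>

lemma mat_slice_uniform_tensor:
  assumes "Y \<in> ops c" "p < c" "q < c"
  shows "mat_slice d c (uniform_state d \<otimes>\<^sub>M Y) p q = Y $$ (p, q) \<cdot>\<^sub>m uniform_state d"
proof -
  have u: "uniform_state d \<in> ops d" by (simp add: uniform_state_def)
  note * = mat_tensor_index'[OF u assms(1) _ _ assms(2,3)]
  show ?thesis
  proof (rule eq_matI)
    fix i j
    assume "i < dim_row (Y $$ (p, q) \<cdot>\<^sub>m uniform_state d)" "j < dim_col (Y $$ (p, q) \<cdot>\<^sub>m uniform_state d)"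
    then have "i < d" "j < d" using u by auto
    then show "mat_slice d c (uniform_state d \<otimes>\<^sub>M Y) p q $$ (i, j) = (Y $$ (p, q) \<cdot>\<^sub>m uniform_state d) $$ (i, j)"
      using u by (simp add: mat_slice_def *)
  qed (use u in \<open>auto simp: mat_slice_def\<close>)
qed

lemma trace_uniform_state: "0 < d \<Longrightarrow> trace (uniform_state d) = 1"
  by (simp add: trace_def uniform_state_def)

text \<open>The output at X \<otimes> |m\<rangle>\<langle>n| is u \<otimes> Y with Y its reduced
  operator on \<open>C\<close>. Its slice is the number \<open>Y $$ (p, q)\<close> times u, so that
  number is the trace of the slice.\<close>

lemma marginally_uniform_slice:
  assumes mu: "marginally_uniform A C \<Phi>" and pq: "p < dout C" "q < dout C"
  shows "uniform_output A (map_slice A C \<Phi> m n p q)"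
  unfolding uniform_output_def
proof (intro conjI ballI)
  show "map_slice A C \<Phi> m n p q \<in> lin_maps A"
    using mu pq by (intro map_slice_in) (auto simp: marginally_uniform_def channel_def trace_preserving_def)
  fix X assume X: "X \<in> ops (din A)"
  define Y where "Y = ptrace1 (dout A) (dout C) (\<Phi> (X \<otimes>\<^sub>M unit_op (din C) m n))"
  have Y: "Y \<in> ops (dout C)" by (simp add: Y_def ptrace1_def)
  have T: "\<Phi> (X \<otimes>\<^sub>M unit_op (din C) m n) = uniform_state (dout A) \<otimes>\<^sub>M Y"
    using mu X by (simp add: marginally_uniform_def Y_def)
  have eq: "map_slice A C \<Phi> m n p q X = Y $$ (p, q) \<cdot>\<^sub>m uniform_state (dout A)"
    using X by (simp add: map_slice_def T mat_slice_uniform_tensor[OF Y pq])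
  have u: "uniform_state (dout A) \<in> ops (dout A)" by (simp add: uniform_state_def)
  show "map_slice A C \<Phi> m n p q X = trace (map_slice A C \<Phi> m n p q X) \<cdot>\<^sub>m uniform_state (dout A)"
  \<comment> \<open>In output dimension 0 the uniform state has trace 0 instead of 1, but both sides
    are then empty matrices.\<close>
  proof (cases "dout A = 0")
    case True
    then show ?thesis unfolding eq by (intro eq_matI) (auto simp: uniform_state_def)
  next
    case False
    then show ?thesis unfolding eq by (simp add: trace_smult[OF u] trace_uniform_state)
  qed
qed

theorem mainTheorem6:
  fixes A B :: party and \<Theta> :: supermap
  assumes "din A = din B" and "dout A = dout B"
    and "doubly_stochastic A B \<Theta>"
  shows "completely_uniformity_preserving A B \<Theta>"
  unfolding completely_uniformity_preserving_def
proof (intro conjI allI impI)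
  show sc: "superchannel A B \<Theta>" using assms(3) by (simp add: doubly_stochastic_def)
  then have \<Theta>: "\<Theta> \<in> supermaps A B" by (simp add: superchannel_def)
  fix C \<Phi> assume mu: "marginally_uniform A C \<Phi>"
  then have ch: "channel (A \<otimes>\<^sub>P C) \<Phi>" by (simp add: marginally_uniform_def)
  then have P: "\<Phi> \<in> lin_maps (A \<otimes>\<^sub>P C)" by (simp add: channel_def trace_preserving_def)
  let ?Z = "supermap_tensor A B C C \<Theta> (id_supermap C) \<Phi>"
  have Z: "channel (B \<otimes>\<^sub>P C) ?Z" using sc assms(2) ch by (rule superchannel_tensor_id_channel)
  show "marginally_uniform B C ?Z"
    unfolding marginally_uniform_def
  proof (intro conjI ballI Z)
    fix X assume X: "X \<in> ops (din B * din C)"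
    have ZX: "?Z X \<in> ops (dout B * dout C)"
      using Z lin_mapsD(1)[of ?Z "B \<otimes>\<^sub>P C" X] X by (simp add: channel_def trace_preserving_def party_tensor_def)
    \<comment> \<open>Every slice of \<open>\<Phi>\<close> has uniform output, and so has its image
      under \<open>\<Theta>\<close>. The entries of \<open>?Z X\<close> are therefore those of 1
      \<otimes> z, where \<open>z\<close> sums the traces of the slice images, each divided by the
      dimension.\<close>
    define z where "z p q = (\<Sum>m<din C. \<Sum>n<din C.
      trace (\<Theta> (map_slice A C \<Phi> m n p q) (mat_slice (din B) (din C) X m n)) / of_nat (dout B))" for p q
    have entry: "?Z X $$ (r * dout C + p, s * dout C + q) = (if r = s then z p q else 0)"
      if "r < dout B" "s < dout B" "p < dout C" "q < dout C" for r s p q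
    proof -
      have "uniform_output B (\<Theta> (map_slice A C \<Phi> m n p q))" for m n
        using that by (intro doubly_stochastic_uniform_output[OF assms(3,2)] marginally_uniform_slice mu)
      note * = uniform_output_index[OF this mat_slice_carrier that(1,2)]
      show ?thesis
        unfolding supermap_tensor_id_slice[OF \<Theta> P X that(3,4) that(1,2)] * by (simp add: z_def)
    qed
    have u: "uniform_state (dout B) \<in> ops (dout B)" by (simp add: uniform_state_def)
    have pt: "ptrace1 (dout B) (dout C) (?Z X) \<in> ops (dout C)" by (simp add: ptrace1_def)
    have pt_entry: "ptrace1 (dout B) (dout C) (?Z X) $$ (p, q) = of_nat (dout B) * z p q"
      if "p < dout C" "q < dout C" for p q
      using that by (simp add: ptrace1_def entry)
    show "?Z X = uniform_state (dout B) \<otimes>\<^sub>M ptrace1 (dout B) (dout C) (?Z X)" (is "_ = ?R")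
    proof (rule eq_matI)
      have R: "?R \<in> ops (dout B * dout C)" using u pt by simp
      with ZX show "dim_row (?Z X) = dim_row ?R" "dim_col (?Z X) = dim_col ?R" by auto
      fix r s assume "r < dim_row ?R" "s < dim_col ?R"
      with R have rs: "r < dout B * dout C" "s < dout B * dout C" by auto
      note b = div_less_dim[OF rs(1)] div_less_dim[OF rs(2)] mod_less_dim[OF rs(1)] mod_less_dim[OF rs(2)]
      \<comment> \<open>The partial trace contributes the factor \<open>dout B\<close> and the
        uniform state its inverse. They cancel because the index \<open>r\<close> forces
        \<open>dout B\<close> to be positive.\<close>
      have "?R $$ (r, s) = (if r div dout C = s div dout C then z (r mod dout C) (s mod dout C) else 0)"
        unfolding mat_tensor_index[OF u pt rs] pt_entry[OF b(3,4)] using b by (auto simp: uniform_state_def)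
      then show "?Z X $$ (r, s) = ?R $$ (r, s)" using entry[OF b] by simp
    qed
  qed
qed

end
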